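(* Let $(\kappa,\rho)\in(0,1]^2$, and let $(m_{-\infty},m_\infty,n_{-\infty},n_\infty)\in\mathbb{R}^4$ satisfy $m_{-\infty}<m_\infty$ and $n_\infty<n_{-\infty}$. (1) Suppose that $(S_-,S_+)\in\mathcal{S}_0^2$ is an element of $\mathcal{N}_{\kappa,\rho}(m_{-\infty},m_\infty,n_{-\infty},n_\infty)$. Then the quadruple $\{(a_i,b_i,m_i,n_i):i\in\mathbb{Z}\}$ associated to $(S_-,S_+)$ is an element of $\mathrm{ABMN}(\kappa,\rho)$, with boundary data $(m_{-\infty},m_\infty,n_{-\infty},n_\infty)$. (2) Conversely, if $\{(a_i,b_i,m_i,n_i)\in(0,\infty)^2\times\mathbb{R}^2:i\in\mathbb{Z}\}$ with boundary data $(m_{-\infty},m_\infty,n_{-\infty},n_\infty)$ belongs to $\mathrm{ABMN}(\kappa,\rho)$, then the time-invariant strategy pair $(S_-,S_+)\in\mathcal{S}_0^2$ in which Mina stakes $b_i$ and Maxine stakes $a_i$ whenever the counter is at $i$ lies in $\mathcal{N}_{\kappa,\rho}(m_{-\infty},m_\infty,n_{-\infty},n_\infty)$.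
   Context: Here $\mathbb{N}=\{0,1,2,\dots\}$. The game $\mathrm{TLP}(\kappa,\rho)$ (Trail of Lost Pennies), for $(\kappa,\rho)\in(0,1]\times(0,\infty)$. Its data are reals $m_{-\infty}<m_\infty$, $n_\infty<n_{-\infty}$, together with fixed reals $m_*<m_{-\infty}$ and $n_*<n_\infty$. A counter $X:\mathbb{N}\to\mathbb{Z}$ starts at a given $X(0)=\ell\in\mathbb{Z}$. At the $(k+1)$st turn ($k\in\mathbb{N}$) Mina and Maxine offer stakes $S_-(k),S_+(k)\ge 0$. Independently of the past, with probability $\kappa$ the turn is a stake turn: then $X(k+1)=X(k)+1$ with probability $\frac{S_+(k)^\rho}{S_-(k)^\rho+S_+(k)^\rho}$ (taken to be $1/2$ if both stakes are zero) and $X(k+1)=X(k)-1$ otherwise. With probability $1-\kappa$ the turn is a flip turn: then $X(k+1)=X(k)\pm1$ with probability $1/2$ each. Let $E_+=\{X(n)\to\infty\}$, $E_-=\{X(n)\to-\infty\}$, $E=E_-\cup E_+$. Maxine's terminal receipt $T_+$ equals $m_\infty$ on $E_+$, $m_{-\infty}$ on $E_-$ and $m_*$ on $E^c$; Mina's $T_-$ equals $n_\infty$ on $E_+$, $n_{-\infty}$ on $E_-$ and $n_*$ on $E^c$. Running costs are $C_\pm=\sum_{k\ge0}S_\pm(k)$ and net receipts are $P_\pm=T_\pm-C_\pm$. Strategies. $\Lambda_k$ is the set of paths $\psi:\{0,\dots,k\}\to\mathbb{Z}$ with $|\psi(j+1)-\psi(j)|=1$, and $\Lambda=\bigcup_{k\ge0}\Lambda_k$.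 $\mathcal{S}$ is the set of maps $S:\Lambda\to[0,\infty)$; a player using $S$ stakes $S(X|_{\{0,\dots,k\}})$ at the $(k+1)$st turn. $\mathcal{S}_0\subset\mathcal{S}$ is the set of time-invariant strategies: those for which $S(\psi)$ depends only on the terminal value of $\psi$. $\mathbb{P}^\ell_{S_-,S_+}$, $\mathbb{E}^\ell_{S_-,S_+}$ denote the law and expectation of play with $X(0)=\ell$ when Mina uses $S_-$ and Maxine uses $S_+$. The pair $(S_-,S_+)\in\mathcal{S}^2$ is a Nash equilibrium if $\mathbb{E}^\ell_{S_-,S_+}[P_+]\ge\mathbb{E}^\ell_{S_-,S}[P_+]$ and $\mathbb{E}^\ell_{S_-,S_+}[P_-]\ge\mathbb{E}^\ell_{S,S_+}[P_-]$ for all $S\in\mathcal{S}$ and $\ell\in\mathbb{Z}$. $\mathcal{N}_{\kappa,\rho}(m_{-\infty},m_\infty,n_{-\infty},n_\infty)\subset\mathcal{S}^2$ is the set of Nash equilibria. The quadruple associated to $(S_-,S_+)\in\mathcal{S}_0^2$: $b_i$ and $a_i$ are the stakes dictated by $S_-$ and $S_+$ when the counter is at $i$; $m_i=\mathbb{E}^i_{S_-,S_+}[P_+]$ and $n_i=\mathbb{E}^i_{S_-,S_+}[P_-]$. $\mathrm{ABMN}(\kappa,\rho)$ is the set of sequences $(a_i,b_i,m_i,n_i)_{i\in\mathbb{Z}}$ with values in $(0,\infty)^2\times\mathbb{R}^2$ satisfying, for every $i\in\mathbb{Z}$, $$2(a_i^\rho+b_i^\rho)(m_i+a_i)=\big(a_i^\rho(1-\kappa)+b_i^\rho(1+\kappa)\big)m_{i-1}+\big(a_i^\rho(1+\kappa)+b_i^\rho(1-\kappa)\big)m_{i+1},$$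 $$2(a_i^\rho+b_i^\rho)(n_i+b_i)=\big(a_i^\rho(1-\kappa)+b_i^\rho(1+\kappa)\big)n_{i-1}+\big(a_i^\rho(1+\kappa)+b_i^\rho(1-\kappa)\big)n_{i+1},$$ $$(a_i^\rho+b_i^\rho)^2=\rho\kappa\,a_i^{\rho-1}b_i^\rho\,(m_{i+1}-m_{i-1}),\qquad (a_i^\rho+b_i^\rho)^2=\rho\kappa\,a_i^{\rho}b_i^{\rho-1}\,(n_{i-1}-n_{i+1}).$$ Such an element has boundary data $(m_{-\infty},m_\infty,n_{-\infty},n_\infty)$ if $m_{-k}\to m_{-\infty}$, $m_k\to m_\infty$, $n_{-k}\to n_{-\infty}$, $n_k\to n_\infty$ as $k\to\infty$. *)

theory Defs
  imports "HOL-Probability.Probability"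
begin

section \<open>Strategies\<close>

text \<open>A path \<open>\<psi>: {0,...,k} \<rightarrow> \<int>\<close> is the nonempty list of its values.\<close>

definition paths :: "int list set" where
  "paths = {\<psi>. \<psi> \<noteq> [] \<and> (\<forall>j. Suc j < length \<psi> \<longrightarrow> \<bar>\<psi> ! Suc j - \<psi> ! j\<bar> = 1)}"

type_synonym strategy = "int list \<Rightarrow> real"

definition strategies :: "strategy set" where
  "strategies = paths \<rightarrow>\<^sub>E {0..}"

definition time_invariant_strategies :: "strategy set" where
  "time_invariant_strategies =
     {S \<in> strategies. \<forall>\<phi>\<in>paths. \<forall>\<psi>\<in>paths. last \<phi> = last \<psi> \<longrightarrow> S \<phi> = S \<psi>}"

definition stationary_strategy :: "(int \<Rightarrow> real) \<Rightarrow> strategy" where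
  "stationary_strategy s = (\<lambda>\<psi>\<in>paths. s (last \<psi>))"

section \<open>The law of play\<close>

definition stake_win_prob :: "real \<Rightarrow> real \<Rightarrow> real \<Rightarrow> real" where
  "stake_win_prob \<rho> b a =
     (if a = 0 \<and> b = 0 then 1 / 2 else a powr \<rho> / (b powr \<rho> + a powr \<rho>))"

text \<open>One turn, from counter position \<open>x\<close>, with stakes \<open>b\<close> (Mina) and \<open>a\<close> (Maxine).
  The outer coin decides whether it is a stake turn or a flip turn.\<close>

definition turn :: "real \<Rightarrow> real \<Rightarrow> real \<Rightarrow> real \<Rightarrow> int \<Rightarrow> int pmf" where
  "turn \<kappa> \<rho> b a x =
     bernoulli_pmf \<kappa> \<bind> (\<lambda>stake_turn.
       bernoulli_pmf (if stake_turn then stake_win_prob \<rho> b a else 1 / 2) \<bind> (\<lambda>up.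
         return_pmf (if up then x + 1 else x - 1)))"

text \<open>\<open>history X k\<close> is the restriction of \<open>X\<close> to \<open>{0,...,k}\<close>.\<close>

definition history :: "(nat \<Rightarrow> int) \<Rightarrow> nat \<Rightarrow> int list" where
  "history X k = map X [0..<Suc k]"

text \<open>Conditional law of \<open>X(k)\<close> given \<open>X(0), ..., X(k - 1)\<close>.\<close>

fun play_kernel ::
  "real \<Rightarrow> real \<Rightarrow> strategy \<Rightarrow> strategy \<Rightarrow> int \<Rightarrow> nat \<Rightarrow> (nat \<Rightarrow> int) \<Rightarrow> int pmf" where
  "play_kernel \<kappa> \<rho> S\<^sub>m S\<^sub>p l 0 X = return_pmf l"
| "play_kernel \<kappa> \<rho> S\<^sub>m S\<^sub>p l (Suc k) X =
     turn \<kappa> \<rho> (S\<^sub>m (history X k)) (S\<^sub>p (history X k)) (X k)"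

text \<open>The law of the counter \<open>X\<close> with \<open>X(0) = l\<close> when Mina uses \<open>S\<^sub>m\<close> and Maxine uses \<open>S\<^sub>p\<close>,
  as the Ionescu-Tulcea extension of the kernels above; see \<open>play_law_cylinder\<close> below.\<close>

definition play_law ::
  "real \<Rightarrow> real \<Rightarrow> strategy \<Rightarrow> strategy \<Rightarrow> int \<Rightarrow> (nat \<Rightarrow> int) measure" where
  "play_law \<kappa> \<rho> S\<^sub>m S\<^sub>p l =
     projective_family.lim UNIV
       (Ionescu_Tulcea.CI (\<lambda>k X. measure_pmf (play_kernel \<kappa> \<rho> S\<^sub>m S\<^sub>p l k X))
          (\<lambda>_. count_space UNIV))
       (\<lambda>_. count_space UNIV)"

section \<open>Receipts\<close>

text \<open>These serve both players; \<open>u_ninf\<close>, \<open>u_pinf\<close>, \<open>u_star\<close> are the terminal receipts on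
  \<open>E\<^sub>-\<close>, on \<open>E\<^sub>+\<close> and off \<open>E\<close>.\<close>

definition terminal_receipt :: "real \<Rightarrow> real \<Rightarrow> real \<Rightarrow> (nat \<Rightarrow> int) \<Rightarrow> real" where
  "terminal_receipt u_ninf u_pinf u_star X =
     (if filterlim X at_top sequentially then u_pinf
      else if filterlim X at_bot sequentially then u_ninf
      else u_star)"

definition running_cost :: "strategy \<Rightarrow> (nat \<Rightarrow> int) \<Rightarrow> ennreal" where
  "running_cost S X = (\<Sum>k. ennreal (S (history X k)))"

definition net_receipt :: "real \<Rightarrow> real \<Rightarrow> real \<Rightarrow> strategy \<Rightarrow> (nat \<Rightarrow> int) \<Rightarrow> ereal" where
  "net_receipt u_ninf u_pinf u_star S X =
     ereal (terminal_receipt u_ninf u_pinf u_star X) - enn2ereal (running_cost S X)"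

text \<open>Net receipts are bounded above but may have mean \<open>-\<infinity>\<close>, for which the Bochner integral would
  return 0. Hence the extended expectation: mean of the positive part minus mean of the negative
  part (\<open>e2ennreal\<close> truncates negative values to 0).\<close>

definition ext_expectation :: "'a measure \<Rightarrow> ('a \<Rightarrow> ereal) \<Rightarrow> ereal" where
  "ext_expectation M f =
     enn2ereal (\<integral>\<^sup>+x. e2ennreal (f x) \<partial>M) - enn2ereal (\<integral>\<^sup>+x. e2ennreal (- f x) \<partial>M)"

definition mean_receipt_Maxine ::
  "real \<Rightarrow> real \<Rightarrow> real \<Rightarrow> real \<Rightarrow> real \<Rightarrow> strategy \<Rightarrow> strategy \<Rightarrow> int \<Rightarrow> ereal" where
  "mean_receipt_Maxine \<kappa> \<rho> m_ninf m_pinf m_star S\<^sub>m S\<^sub>p l =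
     ext_expectation (play_law \<kappa> \<rho> S\<^sub>m S\<^sub>p l) (net_receipt m_ninf m_pinf m_star S\<^sub>p)"

definition mean_receipt_Mina ::
  "real \<Rightarrow> real \<Rightarrow> real \<Rightarrow> real \<Rightarrow> real \<Rightarrow> strategy \<Rightarrow> strategy \<Rightarrow> int \<Rightarrow> ereal" where
  "mean_receipt_Mina \<kappa> \<rho> n_ninf n_pinf n_star S\<^sub>m S\<^sub>p l =
     ext_expectation (play_law \<kappa> \<rho> S\<^sub>m S\<^sub>p l) (net_receipt n_ninf n_pinf n_star S\<^sub>m)"

section \<open>Nash equilibria and the ABMN equations\<close>

definition nash_equilibria ::
  "real \<Rightarrow> real \<Rightarrow> real \<Rightarrow> real \<Rightarrow> real \<Rightarrow> real \<Rightarrow> real \<Rightarrow> real \<Rightarrow> (strategy \<times> strategy) set" where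
  "nash_equilibria \<kappa> \<rho> m_star n_star m_ninf m_pinf n_ninf n_pinf =
     {(S\<^sub>m, S\<^sub>p) \<in> strategies \<times> strategies. \<forall>S\<in>strategies. \<forall>l.
        mean_receipt_Maxine \<kappa> \<rho> m_ninf m_pinf m_star S\<^sub>m S\<^sub>p l
          \<ge> mean_receipt_Maxine \<kappa> \<rho> m_ninf m_pinf m_star S\<^sub>m S l \<and>
        mean_receipt_Mina \<kappa> \<rho> n_ninf n_pinf n_star S\<^sub>m S\<^sub>p l
          \<ge> mean_receipt_Mina \<kappa> \<rho> n_ninf n_pinf n_star S S\<^sub>p l}"

type_synonym quadruple = "(int \<Rightarrow> real) \<times> (int \<Rightarrow> real) \<times> (int \<Rightarrow> real) \<times> (int \<Rightarrow> real)"

text \<open>The quadruple \<open>(a, b, m, n)\<close> associated to a time-invariant pair. There is at most one, and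
  there is one precisely when all the mean receipts are finite. The stakes at \<open>i\<close> are read off at
  the one-point path \<open>[i]\<close>.\<close>

definition associated_quadruple ::
  "real \<Rightarrow> real \<Rightarrow> real \<Rightarrow> real \<Rightarrow> real \<Rightarrow> real \<Rightarrow> real \<Rightarrow> real \<Rightarrow>
     strategy \<times> strategy \<Rightarrow> quadruple \<Rightarrow> bool" where
  "associated_quadruple \<kappa> \<rho> m_star n_star m_ninf m_pinf n_ninf n_pinf =
     (\<lambda>(S\<^sub>m, S\<^sub>p) (a, b, m, n). \<forall>i.
        a i = S\<^sub>p [i] \<and> b i = S\<^sub>m [i] \<and>
        ereal (m i) = mean_receipt_Maxine \<kappa> \<rho> m_ninf m_pinf m_star S\<^sub>m S\<^sub>p i \<and>
        ereal (n i) = mean_receipt_Mina \<kappa> \<rho> n_ninf n_pinf n_star S\<^sub>m S\<^sub>p i)"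

definition ABMN :: "real \<Rightarrow> real \<Rightarrow> quadruple set" where
  "ABMN \<kappa> \<rho> = {(a, b, m, n). \<forall>i.
     a i > 0 \<and> b i > 0 \<and>
     2 * (a i powr \<rho> + b i powr \<rho>) * (m i + a i) =
       (a i powr \<rho> * (1 - \<kappa>) + b i powr \<rho> * (1 + \<kappa>)) * m (i - 1) +
       (a i powr \<rho> * (1 + \<kappa>) + b i powr \<rho> * (1 - \<kappa>)) * m (i + 1) \<and>
     2 * (a i powr \<rho> + b i powr \<rho>) * (n i + b i) =
       (a i powr \<rho> * (1 - \<kappa>) + b i powr \<rho> * (1 + \<kappa>)) * n (i - 1) +
       (a i powr \<rho> * (1 + \<kappa>) + b i powr \<rho> * (1 - \<kappa>)) * n (i + 1) \<and>
     (a i powr \<rho> + b i powr \<rho>)\<^sup>2 =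
       \<rho> * \<kappa> * a i powr (\<rho> - 1) * b i powr \<rho> * (m (i + 1) - m (i - 1)) \<and>
     (a i powr \<rho> + b i powr \<rho>)\<^sup>2 =
       \<rho> * \<kappa> * a i powr \<rho> * b i powr (\<rho> - 1) * (n (i - 1) - n (i + 1))}"

definition has_boundary_data ::
  "quadruple \<Rightarrow> real \<Rightarrow> real \<Rightarrow> real \<Rightarrow> real \<Rightarrow> bool" where
  "has_boundary_data = (\<lambda>(a, b, m, n) m_ninf m_pinf n_ninf n_pinf.
     (\<lambda>k. m (- int k)) \<longlonglongrightarrow> m_ninf \<and> (\<lambda>k. m (int k)) \<longlonglongrightarrow> m_pinf \<and>
     (\<lambda>k. n (- int k)) \<longlonglongrightarrow> n_ninf \<and> (\<lambda>k. n (int k)) \<longlonglongrightarrow> n_pinf)"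

section \<open>Well-definedness of the law of play\<close>

lemma history_cong: "(\<And>j. j \<le> k \<Longrightarrow> X j = Y j) \<Longrightarrow> history X k = history Y k"
  by (simp add: history_def)

lemma play_kernel_cong:
  "(\<And>j. j < k \<Longrightarrow> X j = Y j) \<Longrightarrow> play_kernel \<kappa> \<rho> S\<^sub>m S\<^sub>p l k X = play_kernel \<kappa> \<rho> S\<^sub>m S\<^sub>p l k Y"
  by (cases k) (simp_all add: history_cong[of _ X Y])

lemma PiM_count_space_int:
  "PiM {0..<k::nat} (\<lambda>_. count_space (UNIV::int set)) = count_space ({0..<k} \<rightarrow>\<^sub>E UNIV)"
  by (rule count_space_PiM_finite) auto

lemma play_Ionescu_Tulcea:
  "Ionescu_Tulcea (\<lambda>k X. measure_pmf (play_kernel \<kappa> \<rho> S\<^sub>m S\<^sub>p l k X)) (\<lambda>_. count_space UNIV)"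
proof
  fix i
  show "(\<lambda>X. measure_pmf (play_kernel \<kappa> \<rho> S\<^sub>m S\<^sub>p l i X))
          \<in> PiM {0..<i} (\<lambda>_. count_space UNIV) \<rightarrow>\<^sub>M subprob_algebra (count_space UNIV)"
    unfolding PiM_count_space_int
    by (auto simp: measure_pmf_in_subprob_algebra)
qed unfold_locales

lemma sets_play_law: "sets (play_law \<kappa> \<rho> S\<^sub>m S\<^sub>p l) = sets (PiM UNIV (\<lambda>_. count_space UNIV))"
proof -
  interpret IT: Ionescu_Tulcea
    "\<lambda>k X. measure_pmf (play_kernel \<kappa> \<rho> S\<^sub>m S\<^sub>p l k X)" "\<lambda>_. count_space UNIV"
    by (rule play_Ionescu_Tulcea)
  show ?thesis by (simp add: play_law_def)
qed

lemma play_law_cylinder: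
  "emeasure (play_law \<kappa> \<rho> S\<^sub>m S\<^sub>p l) {X. \<forall>j<k. X j = Y j} =
     ennreal (\<Prod>j<k. pmf (play_kernel \<kappa> \<rho> S\<^sub>m S\<^sub>p l j Y) (Y j))"
proof -
  let ?M = "\<lambda>_::nat. count_space (UNIV::int set)"
  interpret IT: Ionescu_Tulcea
    "\<lambda>k X. measure_pmf (play_kernel \<kappa> \<rho> S\<^sub>m S\<^sub>p l k X)" ?M
    by (rule play_Ionescu_Tulcea)
  let ?u = "\<lambda>_::nat. undefined :: int"
  have C: "emeasure (IT.C 0 k ?u) {restrict Y {0..<k}} =
     ennreal (\<Prod>j<k. pmf (play_kernel \<kappa> \<rho> S\<^sub>m S\<^sub>p l j Y) (Y j))"
  proof (induction k)
    case 0
    then show ?case by (simp add: PiM_empty restrict_def)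
  next
    case (Suc k)
    have u: "?u \<in> space (PiM {0..<0} ?M)" by (simp add: space_PiM)
    have eP: "emeasure (IT.eP k x) {restrict Y {0..<Suc k}} =
        ennreal (pmf (play_kernel \<kappa> \<rho> S\<^sub>m S\<^sub>p l k Y) (Y k)) * indicator {restrict Y {0..<k}} x"
      if x: "x \<in> space (PiM {0..<k} ?M)" for x
    proof -
      have xe: "x \<in> extensional {0..<k}" using x by (simp add: space_PiM PiE_def)
      have "emeasure (IT.eP k x) {restrict Y {0..<Suc k}} =
        emeasure (play_kernel \<kappa> \<rho> S\<^sub>m S\<^sub>p l k x) {y. x(k := y) = restrict Y {0..<Suc k}}"
        using x by (subst IT.emeasure_eP) (auto simp: PiM_count_space_int vimage_def)
      also have "{y. x(k := y) = restrict Y {0..<Suc k}} =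
          (if x = restrict Y {0..<k} then {Y k} else {})"
      proof -
        have "x(k := y) = restrict Y {0..<Suc k} \<longleftrightarrow> x = restrict Y {0..<k} \<and> y = Y k" for y
        proof
          assume *: "x(k := y) = restrict Y {0..<Suc k}"
          have "x j = restrict Y {0..<k} j" for j
            using fun_cong[OF *, of j] xe by (cases "j < k") (auto simp: extensional_def)
          moreover have "y = Y k" using fun_cong[OF *, of k] by simp
          ultimately show "x = restrict Y {0..<k} \<and> y = Y k" by auto
        qed (auto simp: fun_eq_iff)
        then show ?thesis by auto
      qed
      also have "emeasure (play_kernel \<kappa> \<rho> S\<^sub>m S\<^sub>p l k x) \<dots> =
        ennreal (pmf (play_kernel \<kappa> \<rho> S\<^sub>m S\<^sub>p l k Y) (Y k)) * indicator {restrict Y {0..<k}} x"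
        using play_kernel_cong[of k "restrict Y {0..<k}" Y \<kappa> \<rho> S\<^sub>m S\<^sub>p l]
        by (auto simp: emeasure_pmf_single)
      finally show ?thesis .
    qed
    have "emeasure (IT.C 0 (Suc k) ?u) {restrict Y {0..<Suc k}} =
      (\<integral>\<^sup>+x. emeasure (IT.eP k x) {restrict Y {0..<Suc k}} \<partial>IT.C 0 k ?u)"
    proof -
      have "IT.eP k \<in> IT.C 0 k ?u \<rightarrow>\<^sub>M subprob_algebra (PiM {0..<Suc k} ?M)"
        by (subst measurable_cong_sets[OF IT.sets_C[OF u, of k, unfolded add_0] refl])
           (rule IT.measurable_eP)
      moreover have "space (IT.C 0 k ?u) \<noteq> {}"
        using IT.space_C[OF u, of k] by (simp add: space_PiM PiE_eq_empty_iff)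
      ultimately show ?thesis
        by (simp, subst emeasure_bind[where N="PiM {0..<Suc k} ?M"])
           (simp_all add: PiM_count_space_int)
    qed
    also have "\<dots> = (\<integral>\<^sup>+x. ennreal (pmf (play_kernel \<kappa> \<rho> S\<^sub>m S\<^sub>p l k Y) (Y k)) *
        indicator {restrict Y {0..<k}} x \<partial>IT.C 0 k ?u)"
      using IT.space_C[OF u, of k] by (intro nn_integral_cong eP) simp
    also have "\<dots> = ennreal (pmf (play_kernel \<kappa> \<rho> S\<^sub>m S\<^sub>p l k Y) (Y k)) *
        emeasure (IT.C 0 k ?u) {restrict Y {0..<k}}"
      using IT.sets_C[OF u, of k]
      by (intro nn_integral_cmult_indicator) (simp add: PiM_count_space_int)
    also have "\<dots> = ennreal (\<Prod>j<Suc k. pmf (play_kernel \<kappa> \<rho> S\<^sub>m S\<^sub>p l j Y) (Y j))"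
      unfolding Suc.IH by (simp add: ennreal_mult[symmetric] prod_nonneg mult.commute)
    finally show ?case .
  qed
  have "{X. \<forall>j<k. X j = Y j} = IT.PF.emb UNIV {0..<k} {restrict Y {0..<k}}"
    by (auto simp: prod_emb_def space_PiM restrict_def fun_eq_iff) metis
  then have "emeasure (play_law \<kappa> \<rho> S\<^sub>m S\<^sub>p l) {X. \<forall>j<k. X j = Y j} =
      emeasure (IT.CI {0..<k}) {restrict Y {0..<k}}"
    unfolding play_law_def
    by (simp, intro IT.lim) (auto simp: PiM_count_space_int)
  also have "\<dots> = emeasure (IT.C 0 k ?u) {restrict Y {0..<k}}"
    by (subst IT.emeasure_CI[of _ k]) (auto simp: PiM_count_space_int prod_emb_id)
  finally show ?thesis using C by simp
qed

lemma prob_space_play_law: "prob_space (play_law \<kappa> \<rho> S\<^sub>m S\<^sub>p l)"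
proof
  have "space (play_law \<kappa> \<rho> S\<^sub>m S\<^sub>p l) = UNIV"
    using sets_eq_imp_space_eq[OF sets_play_law] by (simp add: space_PiM)
  then show "emeasure (play_law \<kappa> \<rho> S\<^sub>m S\<^sub>p l) (space (play_law \<kappa> \<rho> S\<^sub>m S\<^sub>p l)) = 1"
    using play_law_cylinder[of \<kappa> \<rho> S\<^sub>m S\<^sub>p l 0] by simp
qed

end

theory Submission
  imports Defs
begin

text \<open>
  Everything rests on the first-step decomposition of the law of play. In part (2), the
  ABMN equations say that \<open>m(X\<^sub>k)\<close> minus Maxine's running cost is a martingale and, since
  \<open>\<rho> \<le> 1\<close> makes the one-turn gain concave in the stake, a supermartingale under any deviation of hers.
  Under the stationary pair the mean cost is finite, so each site, where a fixed positive stake is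
  paid, is visited finitely often: the counter escapes almost surely.

  In part (1), one-shot deviations from an equilibrium show that either both players or neither stake
  at a site, and that neighbouring sites are of the same kind. If nobody ever staked, each player
  could win outright with vanishing total stakes, which cannot suit both. So all stakes are positive and
  first-order conditions give the ABMN equations. Comparing the payoff with the martingale limit shows
  that \<open>(1 - h\<^sub>l) m(-\<infinity>) + h\<^sub>l m(\<infinity>)\<close>, with \<open>h\<^sub>l\<close> the probability of
  \<open>E\<^sub>+\<close> from \<open>l\<close>, is the same for the limits of \<open>m\<close> as for the terminal receipts. As
  \<open>h\<close> is not constant (else strict monotonicity of \<open>m\<close> forces \<open>h = 1\<close> and that of \<open>n\<close> forces
  \<open>h = 0\<close>), the boundary data agree.
\<close>

section \<open>The path space\<close>

abbreviation path_space :: "(nat \<Rightarrow> int) measure" where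
  "path_space \<equiv> PiM UNIV (\<lambda>_. count_space UNIV)"

text \<open>Strategies carry information only on \<open>paths\<close>, and play from
  \<open>l\<close> almost surely produces only histories in this set; hypotheses about stakes are
  therefore stated only here.\<close>

definition paths_from :: "int \<Rightarrow> int list set" where
  "paths_from l = {\<psi> \<in> paths. hd \<psi> = l}"

lemma singleton_paths_from: "[l] \<in> paths_from l"
  by (simp add: paths_from_def paths_def)

lemma Cons_paths_from:
  assumes "\<psi> \<in> paths_from y" "\<bar>y - l\<bar> = 1"
  shows "l # \<psi> \<in> paths_from l"
proof -
  have "\<bar>(l # \<psi>) ! Suc j - (l # \<psi>) ! j\<bar> = 1" if "Suc j < length (l # \<psi>)" for j
    using assms that by (cases j) (auto simp: paths_from_def paths_def hd_conv_nth)
  then show ?thesis by (auto simp: paths_from_def paths_def)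
qed

lemma last_Cons_paths_from: "\<psi> \<in> paths_from y \<Longrightarrow> last (l # \<psi>) = last \<psi>"
  by (auto simp: paths_from_def paths_def)

section \<open>Histories and measurability of receipts\<close>

lemma history_0 [simp]: "history X 0 = [X 0]"
  by (simp add: history_def)

text \<open>Prepending a site to a trajectory prepends it to each history, so play after the first
  turn sees the strategies \<open>\<lambda>\<psi>. S (l # \<psi>)\<close>.\<close>

lemma history_case_nat [simp]: "history (case_nat l X) (Suc k) = l # history X k"
proof -
  have "[0..<Suc (Suc k)] = 0 # map Suc [0..<Suc k]"
    by (subst map_Suc_upt) (simp add: upt_conv_Cons)
  then show ?thesis by (simp add: history_def del: upt_Suc)
qed

lemma last_history [simp]: "last (history X k) = X k"
  by (simp add: history_def)

lemma length_history [simp]: "length (history X k) = Suc k"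
  by (simp add: history_def)

lemma nth_history: "j \<le> k \<Longrightarrow> history X k ! j = X j"
  by (simp add: history_def nth_append)

lemma measurable_component [measurable]: "(\<lambda>X. X k) \<in> path_space \<rightarrow>\<^sub>M count_space UNIV"
  by (rule measurable_component_singleton) simp

lemma measurable_history [measurable]:
  "(\<lambda>X. history X k) \<in> path_space \<rightarrow>\<^sub>M count_space UNIV"
proof -
  have "{X \<in> space path_space. history X k = \<psi>} \<in> sets path_space" for \<psi>
  proof -
    have "history X k = \<psi> \<longleftrightarrow> length \<psi> = Suc k \<and> (\<forall>j<Suc k. X j = \<psi> ! j)" for X
      by (auto simp: list_eq_iff_nth_eq nth_history)
    then show ?thesis by simp
  qed
  then have "(\<lambda>X. history X k) -` {\<psi>} \<inter> space path_space \<in> sets path_space" for \<psi>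
    by (simp add: vimage_def Int_def conj_commute)
  then show ?thesis by (auto simp: measurable_count_space_eq2_countable)
qed

lemma space_play_law [simp]: "space (play_law \<kappa> \<rho> S\<^sub>m S\<^sub>p l) = UNIV"
  using sets_eq_imp_space_eq[OF sets_play_law] by (simp add: space_PiM)

lemma measurable_play_law [simp]:
  "measurable (play_law \<kappa> \<rho> S\<^sub>m S\<^sub>p l) N = measurable path_space N"
  by (rule measurable_cong_sets[OF sets_play_law refl])

lemma measurable_case_nat_path [measurable]: "case_nat l \<in> path_space \<rightarrow>\<^sub>M path_space"
proof (rule measurable_PiM_single')
  fix i :: nat
  show "(\<lambda>X. case_nat l X i) \<in> path_space \<rightarrow>\<^sub>M count_space UNIV"
    by (cases i) auto
qed (auto simp: space_PiM)

lemma measurable_partial_cost [measurable]: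
  "(\<lambda>X. ennreal (S (history X j))) \<in> borel_measurable path_space"
  by (rule measurable_compose[OF measurable_history]) simp

lemma measurable_running_cost [measurable]: "running_cost S \<in> borel_measurable path_space"
  unfolding running_cost_def by measurable

text \<open>Divergence to either infinity is tested on integer thresholds and times, hence by
  countably many conditions on single coordinates.\<close>

lemma measurable_terminal_receipt [measurable]:
  "terminal_receipt u v w \<in> borel_measurable path_space"
proof -
  have 1: "filterlim X at_top sequentially \<longleftrightarrow> (\<forall>Z. \<exists>N. \<forall>n\<ge>N. Z \<le> X n)" for X :: "nat \<Rightarrow> int"
    by (simp add: filterlim_at_top eventually_sequentially)
  have 2: "filterlim X at_bot sequentially \<longleftrightarrow> (\<forall>Z. \<exists>N. \<forall>n\<ge>N. X n \<le> Z)" for X :: "nat \<Rightarrow> int"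
    by (simp add: filterlim_at_bot eventually_sequentially)
  have [measurable]: "Measurable.pred path_space (\<lambda>X. Z \<le> X n)"
    "Measurable.pred path_space (\<lambda>X. X n \<le> Z)" for Z :: int and n
    by (rule measurable_compose[OF measurable_component], simp)+
  show ?thesis unfolding terminal_receipt_def 1 2 by measurable
qed

text \<open>Cylinders over finitely many initial times form a pi-system generating the product sets,
  and finite measures that agree on a generating pi-system are equal.\<close>

lemma path_measure_eqI:
  assumes M: "sets M = sets path_space" and N: "sets N = sets path_space"
    and fin: "emeasure M UNIV \<noteq> \<infinity>"
    and eq: "\<And>k Y. emeasure M {X. \<forall>j<k. X j = Y j} = emeasure N {X. \<forall>j<k. X j = Y j}"
  shows "M = N"
proof -
  define E where "E = insert {} (range (\<lambda>(k::nat, Y::nat\<Rightarrow>int). {X. \<forall>j<k. X j = Y j}))"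
  have cyl: "{X. \<forall>j<k. X j = Y j} \<in> E" for k Y
    unfolding E_def by auto
  have stable: "Int_stable E"
  proof (rule Int_stableI)
    fix A B assume "A \<in> E" "B \<in> E"
    show "A \<inter> B \<in> E"
    proof (cases "A \<inter> B = {}")
      case True then show ?thesis by (simp add: E_def)
    next
      case False
      then obtain Z where Z: "Z \<in> A" "Z \<in> B" by auto
      then obtain k Y k' Y' where A: "A = {X. \<forall>j<k. X j = Y j}" and B: "B = {X. \<forall>j<k'. X j = Y' j}"
        using \<open>A \<in> E\<close> \<open>B \<in> E\<close> unfolding E_def by auto
      \<comment> \<open>A common point can serve as the centre of both cylinders, so the longer of
        the two is their intersection.\<close>
      have "A \<inter> B = {X. \<forall>j<max k k'. X j = Z j}"
        using Z unfolding A B by (auto simp: less_max_iff_disj)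
      then show ?thesis using cyl by simp
    qed
  qed
  have UN: "UNIV \<in> E" using cyl[of 0 "\<lambda>_. 0"] by simp
  have sp: "space path_space = UNIV" by (simp add: space_PiM)
  have gen: "sets path_space = sigma_sets UNIV E"
  proof
    interpret S: sigma_algebra UNIV "sigma_sets UNIV E"
      by (rule sigma_algebra_sigma_sets) simp
    have comp: "{X. X i \<in> A} \<in> sigma_sets UNIV E" for i :: nat and A :: "int set"
    proof -
      \<comment> \<open>There are only countably many finite lists, so an event at time
        \<open>i\<close> is a countable union of cylinders of length \<open>Suc i\<close>.\<close>
      have "{X. X i \<in> A} = (\<Union>ys\<in>{ys. length ys = Suc i \<and> ys ! i \<in> A}. {X. \<forall>j<Suc i. X j = ys ! j})"
      proof (intro set_eqI iffI)
        fix X assume "X \<in> {X. X i \<in> A}"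
        then show "X \<in> (\<Union>ys\<in>{ys. length ys = Suc i \<and> ys ! i \<in> A}. {X. \<forall>j<Suc i. X j = ys ! j})"
          by (intro UN_I[of "history X i"]) (auto simp: nth_history)
      qed auto
      moreover have "\<dots> \<in> sigma_sets UNIV E"
        by (rule S.countable_UN') (auto intro!: sigma_sets.Basic cyl)
      ultimately show ?thesis by simp
    qed
    show "sets path_space \<subseteq> sigma_sets UNIV E"
      unfolding sets_PiM_single using comp
      by (simp add: PiE_UNIV_domain) (rule sigma_sets_mono, auto)
    have "{X. \<forall>j<k. X j = Y j} \<in> sets path_space" for k and Y :: "nat \<Rightarrow> int"
    proof -
      have "{X \<in> space path_space. \<forall>j<k. X j = Y j} \<in> sets path_space" by measurable
      then show ?thesis by (simp add: sp)
    qed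
    then have "E \<subseteq> sets path_space" by (auto simp: E_def)
    from sets.sigma_sets_subset[OF this]
    show "sigma_sets UNIV E \<subseteq> sets path_space" by (simp add: sp)
  qed
  show ?thesis
  proof (rule measure_eqI_generator_eq[OF stable, where \<Omega>=UNIV and A="\<lambda>_. UNIV"])
    show "sets M = sigma_sets UNIV E" "sets N = sigma_sets UNIV E"
      using M N gen by auto
    show "emeasure M X = emeasure N X" if "X \<in> E" for X
      using that eq by (auto simp: E_def)
  qed (use UN fin in auto)
qed

section \<open>The Markov property at time one\<close>

definition up_prob :: "real \<Rightarrow> real \<Rightarrow> real \<Rightarrow> real \<Rightarrow> real" where
  "up_prob \<kappa> \<rho> b a = (1 - \<kappa>) / 2 + \<kappa> * stake_win_prob \<rho> b a"

lemma stake_win_prob_bounds: "0 \<le> stake_win_prob \<rho> b a" "stake_win_prob \<rho> b a \<le> 1"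
  by (auto simp: stake_win_prob_def intro!: divide_le_eq_1[THEN iffD2])
     (metis add_nonneg_eq_0_iff add_nonneg_nonneg order_less_le powr_ge_zero)+

lemma up_prob_bounds:
  assumes "0 \<le> \<kappa>" "\<kappa> \<le> 1"
  shows "0 \<le> up_prob \<kappa> \<rho> b a" "up_prob \<kappa> \<rho> b a \<le> 1"
proof -
  have "0 \<le> \<kappa> * stake_win_prob \<rho> b a" "\<kappa> * stake_win_prob \<rho> b a \<le> \<kappa> * 1"
    using assms stake_win_prob_bounds[of \<rho> b a] by (intro mult_nonneg_nonneg mult_left_mono; simp)+
  then show "0 \<le> up_prob \<kappa> \<rho> b a" "up_prob \<kappa> \<rho> b a \<le> 1"
    using assms by (auto simp: up_prob_def field_simps)
qed

lemma nn_integral_turn: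
  assumes "0 \<le> \<kappa>" "\<kappa> \<le> 1"
  shows "(\<integral>\<^sup>+y. f y \<partial>turn \<kappa> \<rho> b a x) =
    ennreal (up_prob \<kappa> \<rho> b a) * f (x + 1) + ennreal (1 - up_prob \<kappa> \<rho> b a) * f (x - 1)"
proof -
  let ?w = "stake_win_prob \<rho> b a"
  have "(\<integral>\<^sup>+y. f y \<partial>turn \<kappa> \<rho> b a x) =
      (f (x + 1) * ennreal ?w + f (x - 1) * ennreal (1 - ?w)) * ennreal \<kappa> +
      f (x + 1) * ennreal ((1 - \<kappa>) / 2) + f (x - 1) * ennreal ((1 - \<kappa>) / 2)"
  proof -
    have "ennreal ((1 - \<kappa>) / 2) = ennreal (1/2) * ennreal (1 - \<kappa>)"
      using assms by (subst ennreal_mult[symmetric]) auto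
    then show ?thesis
      unfolding turn_def using assms stake_win_prob_bounds[of \<rho> b a]
      by (simp add: nn_integral_bernoulli_pmf ring_distribs ac_simps)
  qed
  also have "\<dots> = f (x + 1) * (ennreal ?w * ennreal \<kappa> + ennreal ((1 - \<kappa>) / 2)) +
      f (x - 1) * (ennreal (1 - ?w) * ennreal \<kappa> + ennreal ((1 - \<kappa>) / 2))"
    by (simp only: ring_distribs ac_simps)
  also have "ennreal ?w * ennreal \<kappa> + ennreal ((1 - \<kappa>) / 2) = ennreal (up_prob \<kappa> \<rho> b a)"
    using assms stake_win_prob_bounds[of \<rho> b a] mult_left_le[of ?w \<kappa>]
    by (simp add: ennreal_mult[symmetric] ennreal_plus[symmetric] up_prob_def field_simps
        del: ennreal_plus)
  also have "ennreal (1 - ?w) * ennreal \<kappa> + ennreal ((1 - \<kappa>) / 2) = ennreal (1 - up_prob \<kappa> \<rho> b a)"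
    using assms stake_win_prob_bounds[of \<rho> b a] mult_left_le[of ?w \<kappa>]
    by (simp add: ennreal_mult[symmetric] ennreal_plus[symmetric] up_prob_def field_simps
        del: ennreal_plus)
  finally show ?thesis by (simp add: mult.commute)
qed

text \<open>By uniqueness on cylinders: the product in \<open>play_law_cylinder\<close> begins with
  the point mass at \<open>l\<close> and the first turn, and its remaining factors are those of play
  restarted at the new site with strategies that remember \<open>l\<close>.\<close>

lemma play_law_eq_bind:
  "play_law \<kappa> \<rho> S\<^sub>m S\<^sub>p l =
     measure_pmf (turn \<kappa> \<rho> (S\<^sub>m [l]) (S\<^sub>p [l]) l) \<bind> (\<lambda>y.
       distr (play_law \<kappa> \<rho> (\<lambda>\<psi>. S\<^sub>m (l # \<psi>)) (\<lambda>\<psi>. S\<^sub>p (l # \<psi>)) y) path_space (case_nat l))"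
  (is "?P = measure_pmf ?t \<bind> ?D")
proof (rule path_measure_eqI)
  let ?Q = "play_law \<kappa> \<rho> (\<lambda>\<psi>. S\<^sub>m (l # \<psi>)) (\<lambda>\<psi>. S\<^sub>p (l # \<psi>))"
  show "sets ?P = sets path_space" by (rule sets_play_law)
  have "subprob_space (?D y)" for y
    by (intro prob_space_imp_subprob_space prob_space.prob_space_distr prob_space_play_law) simp
  then have D: "?D \<in> measure_pmf ?t \<rightarrow>\<^sub>M subprob_algebra path_space"
    by (auto simp: space_subprob_algebra)
  show "sets (measure_pmf ?t \<bind> ?D) = sets path_space"
    by (rule sets_bind[OF sets_kernel[OF D]]) auto
  show "emeasure ?P UNIV \<noteq> \<infinity>"
    using prob_space.emeasure_space_1[OF prob_space_play_law, of \<kappa> \<rho> S\<^sub>m S\<^sub>p l] by simp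
  fix k :: nat and Y :: "nat \<Rightarrow> int"
  have meas: "{X. \<forall>j<n. X j = Y j} \<in> sets path_space" for n Y
  proof -
    have "{X \<in> space path_space. \<forall>j<n. X j = Y j} \<in> sets path_space" by measurable
    then show ?thesis by (simp add: space_PiM)
  qed
  have N: "emeasure (measure_pmf ?t \<bind> ?D) {X. \<forall>j<k. X j = Y j} =
    (\<integral>\<^sup>+y. emeasure (?Q y) {X. \<forall>j<k. case_nat l X j = Y j} \<partial>?t)"
    by (subst emeasure_bind[OF _ D meas])
       (auto simp: emeasure_distr meas vimage_def sets_play_law)
  show "emeasure ?P {X. \<forall>j<k. X j = Y j} = emeasure (measure_pmf ?t \<bind> ?D) {X. \<forall>j<k. X j = Y j}"
  proof (cases k)
    case 0
    then show ?thesis unfolding N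
      using prob_space.emeasure_space_1[OF prob_space_play_law] by simp
  next
    case (Suc n)
    show ?thesis
    proof (cases "Y 0 = l")
      case False
      then have "{X. \<forall>j<k. case_nat l X j = Y j} = {}"
        using Suc by (auto intro!: exI[of _ 0])
      then have "emeasure (measure_pmf ?t \<bind> ?D) {X. \<forall>j<k. X j = Y j} = 0"
        unfolding N by (simp only: emeasure_empty nn_integral_const) simp
      moreover have "emeasure ?P {X. \<forall>j<k. X j = Y j} = 0"
        unfolding play_law_cylinder Suc using False
        by (subst prod.lessThan_Suc_shift) (simp add: pmf_return)
      ultimately show ?thesis by simp
    next
      case True
      have eq: "{X. \<forall>j<k. case_nat l X j = Y j} = {X. \<forall>j<n. X j = Y (Suc j)}"
        using True Suc by (auto simp: less_Suc_eq_0_disj)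
      have Y: "case_nat l (\<lambda>j. Y (Suc j)) = Y"
        using True by (auto split: nat.split)
      have h: "l # history (\<lambda>j. Y (Suc j)) j = history Y (Suc j)" for j
        using history_case_nat[of l "\<lambda>j. Y (Suc j)" j] unfolding Y by simp
      show ?thesis
      proof (cases n)
        case 0
        have "{X. \<forall>j<k. X j = Y j} = {X. \<forall>j<Suc 0. X j = Y j}" using Suc 0 by auto
        then have "emeasure ?P {X. \<forall>j<k. X j = Y j} = 1"
          unfolding play_law_cylinder using True Suc 0 by (simp add: pmf_return)
        then show ?thesis unfolding N eq 0
          using prob_space.emeasure_space_1[OF prob_space_play_law] by simp
      next
        case (Suc n')
        \<comment> \<open>\<open>?r\<close> collects the turns after the first. It occurs in both
          products, which differ only in whether \<open>Y 1\<close> is weighted by the first turn or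
          selected as a starting point.\<close>
        let ?r = "\<Prod>j<n'. pmf (turn \<kappa> \<rho> (S\<^sub>m (history Y (Suc j))) (S\<^sub>p (history Y (Suc j))) (Y (Suc j))) (Y (Suc (Suc j)))"
        have "emeasure ?P {X. \<forall>j<k. X j = Y j} = ennreal (pmf ?t (Y 1) * ?r)"
          unfolding play_law_cylinder \<open>k = Suc n\<close> \<open>n = Suc n'\<close>
          by (simp only: prod.lessThan_Suc_shift) (simp add: True del: prod.lessThan_Suc)
        also have "\<dots> = (\<integral>\<^sup>+y. ennreal ?r * indicator {Y 1} y \<partial>?t)"
          by (subst nn_integral_cmult)
             (simp_all add: emeasure_pmf_single ennreal_mult prod_nonneg mult.commute)
        also have "\<dots> = (\<integral>\<^sup>+y. emeasure (?Q y) {X. \<forall>j<n. X j = Y (Suc j)} \<partial>?t)"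
        proof (rule nn_integral_cong)
          fix y
          show "ennreal ?r * indicator {Y 1} y = emeasure (?Q y) {X. \<forall>j<n. X j = Y (Suc j)}"
            unfolding play_law_cylinder \<open>n = Suc n'\<close>
            by (simp only: prod.lessThan_Suc_shift)
               (auto simp add: h pmf_return indicator_def simp del: prod.lessThan_Suc)
        qed
        finally show ?thesis unfolding N eq .
      qed
    qed
  qed
qed

locale trail_of_lost_pennies =
  fixes \<kappa> \<rho> :: real
  assumes \<kappa>: "0 < \<kappa>" "\<kappa> \<le> 1" and \<rho>: "0 < \<rho>" "\<rho> \<le> 1"
begin

abbreviation "up \<equiv> up_prob \<kappa> \<rho>"

abbreviation "law \<equiv> play_law \<kappa> \<rho>"

lemma up_bounds: "0 \<le> up b a" "up b a \<le> 1"
  using up_prob_bounds[of \<kappa> \<rho> b a] \<kappa> by auto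

lemma emeasure_law_UNIV [simp]: "emeasure (law S\<^sub>m S\<^sub>p l) UNIV = 1"
  using prob_space.emeasure_space_1[OF prob_space_play_law] by simp

text \<open>Stating the first-step analysis for nonnegative functionals avoids integrability
  conditions; signed quantities are shifted by constants before it is applied.\<close>

lemma nn_integral_law_shift:
  assumes [measurable]: "F \<in> borel_measurable path_space"
  shows "(\<integral>\<^sup>+X. F X \<partial>law S\<^sub>m S\<^sub>p l) =
    ennreal (up (S\<^sub>m [l]) (S\<^sub>p [l])) *
      (\<integral>\<^sup>+X. F (case_nat l X) \<partial>law (\<lambda>\<psi>. S\<^sub>m (l # \<psi>)) (\<lambda>\<psi>. S\<^sub>p (l # \<psi>)) (l + 1)) +
    ennreal (1 - up (S\<^sub>m [l]) (S\<^sub>p [l])) *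
      (\<integral>\<^sup>+X. F (case_nat l X) \<partial>law (\<lambda>\<psi>. S\<^sub>m (l # \<psi>)) (\<lambda>\<psi>. S\<^sub>p (l # \<psi>)) (l - 1))"
proof -
  let ?Q = "law (\<lambda>\<psi>. S\<^sub>m (l # \<psi>)) (\<lambda>\<psi>. S\<^sub>p (l # \<psi>))"
  have "subprob_space (distr (?Q y) path_space (case_nat l))" for y
    by (intro prob_space_imp_subprob_space prob_space.prob_space_distr prob_space_play_law) simp
  then have D: "(\<lambda>y. distr (?Q y) path_space (case_nat l)) \<in>
      measure_pmf (turn \<kappa> \<rho> (S\<^sub>m [l]) (S\<^sub>p [l]) l) \<rightarrow>\<^sub>M subprob_algebra path_space"
    by (auto simp: space_subprob_algebra)
  show ?thesis
    by (subst play_law_eq_bind, subst nn_integral_bind[OF assms D])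
       (use \<kappa> in \<open>simp add: nn_integral_distr nn_integral_turn\<close>)
qed

text \<open>Induction on the length of a cylinder: the first turn depends on the stakes at
  \<open>[l]\<close> alone, and prepending \<open>l\<close> sends paths from a neighbour to paths
  from \<open>l\<close>, so agreement passes to the shifted strategies.\<close>

lemma law_cong:
  assumes "\<And>\<psi>. \<psi> \<in> paths_from l \<Longrightarrow> S\<^sub>m \<psi> = S\<^sub>m' \<psi>" "\<And>\<psi>. \<psi> \<in> paths_from l \<Longrightarrow> S\<^sub>p \<psi> = S\<^sub>p' \<psi>"
  shows "law S\<^sub>m S\<^sub>p l = law S\<^sub>m' S\<^sub>p' l"
proof (rule path_measure_eqI)
  have meas: "{X. \<forall>j<n. X j = Y j} \<in> sets path_space" for n :: nat and Y :: "nat \<Rightarrow> int"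
  proof -
    have "{X \<in> space path_space. \<forall>j<n. X j = Y j} \<in> sets path_space" by measurable
    then show ?thesis by (simp add: space_PiM)
  qed
  fix k and Y :: "nat \<Rightarrow> int"
  have "(\<integral>\<^sup>+X. indicator {X. \<forall>j<k. X j = Y j} X \<partial>law S\<^sub>m S\<^sub>p l) =
        (\<integral>\<^sup>+X. indicator {X. \<forall>j<k. X j = Y j} X \<partial>law S\<^sub>m' S\<^sub>p' l)"
    using assms
  proof (induction k arbitrary: Y l S\<^sub>m S\<^sub>p S\<^sub>m' S\<^sub>p')
    case 0
    then show ?case by simp
  next
    case (Suc k)
    have eq: "indicator {X. \<forall>j<Suc k. X j = Y j} (case_nat l X) =
        (if Y 0 = l then indicator {X. \<forall>j<k. X j = Y (Suc j)} X else (0::ennreal))" for X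
      by (auto simp: indicator_def less_Suc_eq_0_disj)
    have stake: "S\<^sub>m [l] = S\<^sub>m' [l]" "S\<^sub>p [l] = S\<^sub>p' [l]"
      using Suc.prems singleton_paths_from by auto
    have "(\<integral>\<^sup>+X. indicator {X. \<forall>j<k. X j = Y (Suc j)} X \<partial>law (\<lambda>\<psi>. S\<^sub>m (l # \<psi>)) (\<lambda>\<psi>. S\<^sub>p (l # \<psi>)) y) =
        (\<integral>\<^sup>+X. indicator {X. \<forall>j<k. X j = Y (Suc j)} X \<partial>law (\<lambda>\<psi>. S\<^sub>m' (l # \<psi>)) (\<lambda>\<psi>. S\<^sub>p' (l # \<psi>)) y)"
      if "\<bar>y - l\<bar> = 1" for y
      by (rule Suc.IH) (auto intro!: Suc.prems Cons_paths_from[OF _ that])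
    from this[of "l + 1"] this[of "l - 1"] show ?case
      by (subst (1 2) nn_integral_law_shift) (cases "Y 0 = l"; simp add: meas eq stake)+
  qed
  then show "emeasure (law S\<^sub>m S\<^sub>p l) {X. \<forall>j<k. X j = Y j} = emeasure (law S\<^sub>m' S\<^sub>p' l) {X. \<forall>j<k. X j = Y j}"
    by (simp add: meas sets_play_law)
qed (simp_all add: sets_play_law)

lemma nn_integral_law_step:
  assumes "F \<in> borel_measurable path_space"
    and "\<And>y \<psi>. \<bar>y - l\<bar> = 1 \<Longrightarrow> \<psi> \<in> paths_from y \<Longrightarrow> S\<^sub>m (l # \<psi>) = S\<^sub>m' \<psi>"
    and "\<And>y \<psi>. \<bar>y - l\<bar> = 1 \<Longrightarrow> \<psi> \<in> paths_from y \<Longrightarrow> S\<^sub>p (l # \<psi>) = S\<^sub>p' \<psi>"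
  shows "(\<integral>\<^sup>+X. F X \<partial>law S\<^sub>m S\<^sub>p l) =
    ennreal (up (S\<^sub>m [l]) (S\<^sub>p [l])) * (\<integral>\<^sup>+X. F (case_nat l X) \<partial>law S\<^sub>m' S\<^sub>p' (l + 1)) +
    ennreal (1 - up (S\<^sub>m [l]) (S\<^sub>p [l])) * (\<integral>\<^sup>+X. F (case_nat l X) \<partial>law S\<^sub>m' S\<^sub>p' (l - 1))"
proof -
  have "law (\<lambda>\<psi>. S\<^sub>m (l # \<psi>)) (\<lambda>\<psi>. S\<^sub>p (l # \<psi>)) y = law S\<^sub>m' S\<^sub>p' y" if "\<bar>y - l\<bar> = 1" for y
    by (rule law_cong) (use assms that in auto)
  then show ?thesis
    by (subst nn_integral_law_shift[OF assms(1)]) simp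
qed

text \<open>Induction on time: if \<open>l # \<psi>\<close> is not a path from \<open>l\<close>
  although its first step has length one, then \<open>\<psi>\<close> already fails to be a path from
  the second site.\<close>

lemma AE_history_paths_from: "AE X in law S\<^sub>m S\<^sub>p l. \<forall>k. history X k \<in> paths_from l"
proof -
  have "(\<integral>\<^sup>+X. indicator (- paths_from l) (history X k) \<partial>law S\<^sub>m S\<^sub>p l) = 0" for k
  proof (induction k arbitrary: l S\<^sub>m S\<^sub>p)
    case 0
    then show ?case
      by (subst nn_integral_law_shift) (simp_all add: singleton_paths_from)
  next
    case (Suc k)
    have "(\<integral>\<^sup>+X. indicator (- paths_from l) (l # history X k) \<partial>law S\<^sub>m S\<^sub>p y) = 0"
      if "\<bar>y - l\<bar> = 1" for S\<^sub>m S\<^sub>p y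
    proof -
      have "(\<integral>\<^sup>+X. indicator (- paths_from l) (l # history X k) \<partial>law S\<^sub>m S\<^sub>p y) \<le>
          (\<integral>\<^sup>+X. indicator (- paths_from y) (history X k) \<partial>law S\<^sub>m S\<^sub>p y)"
        by (intro nn_integral_mono) (auto simp: indicator_def dest: Cons_paths_from[OF _ that])
      then show ?thesis by (simp add: Suc)
    qed
    from this[of "l + 1"] this[of "l - 1"] show ?case
      by (subst nn_integral_law_shift) simp_all
  qed
  then have "AE X in law S\<^sub>m S\<^sub>p l. history X k \<in> paths_from l" for k
    by (subst (asm) nn_integral_0_iff_AE) (simp_all add: indicator_def split: if_splits)
  then show ?thesis by (simp add: AE_all_countable)
qed

lemma AE_nearest_neighbour: "AE X in law S\<^sub>m S\<^sub>p l. \<forall>k. \<bar>X (Suc k) - X k\<bar> = 1"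
  using AE_history_paths_from
proof eventually_elim
  case (elim X)
  have "\<bar>X (Suc k) - X k\<bar> = 1" for k
  proof -
    from elim have "history X (Suc k) \<in> paths" by (auto simp: paths_from_def)
    then have "\<bar>history X (Suc k) ! Suc k - history X (Suc k) ! k\<bar> = 1"
      by (auto simp: paths_def)
    then show ?thesis by (simp add: nth_history)
  qed
  then show ?case by simp
qed

text \<open>The expected Doob decomposition of \<open>u(X\<^sub>k)\<close>, with compensator increments \<open>S - D\<close> and both
  sides moved so that only nonnegative integrals occur.\<close>

lemma expectation_telescope:
  assumes c: "\<And>i. c \<le> u i"
    and nonneg: "\<And>\<psi>. \<psi> \<in> paths_from l \<Longrightarrow> 0 \<le> S \<psi>" "\<And>\<psi>. \<psi> \<in> paths_from l \<Longrightarrow> 0 \<le> D \<psi>"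
    and step: "\<And>\<psi>. \<psi> \<in> paths_from l \<Longrightarrow> u (last \<psi>) + S \<psi> =
      up (S\<^sub>m \<psi>) (S\<^sub>p \<psi>) * u (last \<psi> + 1) + (1 - up (S\<^sub>m \<psi>) (S\<^sub>p \<psi>)) * u (last \<psi> - 1) + D \<psi>"
  shows "(\<integral>\<^sup>+X. ennreal (u (X k) - c) \<partial>law S\<^sub>m S\<^sub>p l) +
      (\<integral>\<^sup>+X. (\<Sum>j<k. ennreal (D (history X j))) \<partial>law S\<^sub>m S\<^sub>p l) =
    ennreal (u l - c) + (\<integral>\<^sup>+X. (\<Sum>j<k. ennreal (S (history X j))) \<partial>law S\<^sub>m S\<^sub>p l)"
  using nonneg step
proof (induction k arbitrary: l S\<^sub>m S\<^sub>p S D)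
  case 0
  have "(\<integral>\<^sup>+X. ennreal (u (X 0) - c) \<partial>law S\<^sub>m S\<^sub>p l) = ennreal (u l - c)"
    using up_bounds[of "S\<^sub>m [l]" "S\<^sub>p [l]"]
    by (subst nn_integral_law_shift)
       (simp_all add: distrib_right[symmetric] ennreal_plus[symmetric] del: ennreal_plus)
  then show ?case by simp
next
  case (Suc k)
  define p where "p = up (S\<^sub>m [l]) (S\<^sub>p [l])"
  have p: "0 \<le> p" "p \<le> 1" using up_bounds by (auto simp: p_def)
  let ?L = "law (\<lambda>\<psi>. S\<^sub>m (l # \<psi>)) (\<lambda>\<psi>. S\<^sub>p (l # \<psi>))"
  define U where "U y = (\<integral>\<^sup>+X. ennreal (u (X k) - c) \<partial>?L y)" for y
  define I where "I S y = (\<integral>\<^sup>+X. (\<Sum>j<k. ennreal (S (l # history X j))) \<partial>?L y)" for S y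
  have sum: "(\<integral>\<^sup>+X. (\<Sum>j<Suc k. ennreal (S (history X j))) \<partial>law S\<^sub>m S\<^sub>p l) =
      ennreal (S [l]) + (ennreal p * I S (l + 1) + ennreal (1 - p) * I S (l - 1))" for S
  proof -
    have "(\<integral>\<^sup>+X. (\<Sum>j<Suc k. ennreal (S (history X j))) \<partial>law S\<^sub>m S\<^sub>p l) =
      ennreal p * (ennreal (S [l]) + I S (l + 1)) + ennreal (1 - p) * (ennreal (S [l]) + I S (l - 1))"
      by (subst nn_integral_law_shift)
         (simp_all add: sum.lessThan_Suc_shift nn_integral_add I_def p_def del: sum.lessThan_Suc)
    also have "\<dots> = (ennreal p + ennreal (1 - p)) * ennreal (S [l]) +
        (ennreal p * I S (l + 1) + ennreal (1 - p) * I S (l - 1))"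
      by (simp only: ring_distribs ac_simps)
    finally show ?thesis using p by (simp add: ennreal_plus[symmetric] del: ennreal_plus)
  qed
  have U: "(\<integral>\<^sup>+X. ennreal (u (X (Suc k)) - c) \<partial>law S\<^sub>m S\<^sub>p l) = ennreal p * U (l + 1) + ennreal (1 - p) * U (l - 1)"
    by (subst nn_integral_law_shift) (simp_all add: U_def p_def)
  \<comment> \<open>The induction hypothesis is used for play restarted from a neighbour, with
    \<open>S\<close> and \<open>D\<close> also reading the prefixed path.\<close>
  have IH: "U y + I D y = ennreal (u y - c) + I S y" if y: "\<bar>y - l\<bar> = 1" for y
    unfolding U_def I_def
  proof (rule Suc.IH)
    fix \<psi> assume \<psi>: "\<psi> \<in> paths_from y"
    note * = Cons_paths_from[OF \<psi> y] last_Cons_paths_from[OF \<psi>, of l]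
    show "0 \<le> S (l # \<psi>)" "0 \<le> D (l # \<psi>)" using Suc.prems * by auto
    show "u (last \<psi>) + S (l # \<psi>) =
      up (S\<^sub>m (l # \<psi>)) (S\<^sub>p (l # \<psi>)) * u (last \<psi> + 1) + (1 - up (S\<^sub>m (l # \<psi>)) (S\<^sub>p (l # \<psi>))) * u (last \<psi> - 1) +
      D (l # \<psi>)"
      using Suc.prems(3)[OF *(1)] *(2) by simp
  qed
  \<comment> \<open>This is the hypothesis at the one-point path \<open>[l]\<close>, rewritten for
    \<open>u - c\<close> so that every summand is nonnegative and it transfers to
    \<open>ennreal\<close>.\<close>
  have "ennreal p * ennreal (u (l + 1) - c) + ennreal (1 - p) * ennreal (u (l - 1) - c) + ennreal (D [l]) =
      ennreal (u l - c) + ennreal (S [l])"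
  proof -
    have "p * (u (l + 1) - c) + (1 - p) * (u (l - 1) - c) + D [l] = (u l - c) + S [l]"
      using Suc.prems(3)[OF singleton_paths_from] by (simp add: p_def algebra_simps)
    moreover have "0 \<le> p * (u (l + 1) - c)" "0 \<le> (1 - p) * (u (l - 1) - c)"
      using p c by simp_all
    moreover have "0 \<le> D [l]" "0 \<le> S [l]" "0 \<le> u l - c"
      using Suc.prems(1,2)[OF singleton_paths_from] c by simp_all
    ultimately show ?thesis
      using p c by (simp add: ennreal_mult[symmetric] ennreal_plus[symmetric] del: ennreal_plus)
  qed
  note 1 = this
  have "ennreal p * U (l + 1) + ennreal (1 - p) * U (l - 1) +
      (ennreal (D [l]) + (ennreal p * I D (l + 1) + ennreal (1 - p) * I D (l - 1))) =
     ennreal p * (U (l + 1) + I D (l + 1)) + ennreal (1 - p) * (U (l - 1) + I D (l - 1)) + ennreal (D [l])"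
    by (simp only: ring_distribs ac_simps)
  also have "\<dots> = ennreal p * (ennreal (u (l + 1) - c) + I S (l + 1)) +
      ennreal (1 - p) * (ennreal (u (l - 1) - c) + I S (l - 1)) + ennreal (D [l])"
    by (simp add: IH)
  also have "\<dots> = (ennreal p * ennreal (u (l + 1) - c) + ennreal (1 - p) * ennreal (u (l - 1) - c) + ennreal (D [l])) +
      (ennreal p * I S (l + 1) + ennreal (1 - p) * I S (l - 1))"
    by (simp only: ring_distribs ac_simps)
  also have "\<dots> = ennreal (u l - c) +
      (ennreal (S [l]) + (ennreal p * I S (l + 1) + ennreal (1 - p) * I S (l - 1)))"
    unfolding 1 by (simp only: ac_simps)
  finally show ?case unfolding sum U .
qed

end

section \<open>Expected receipts\<close>

text \<open>The receipt is bounded and the cost nonnegative, so the positive part has finite mean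
  and the difference is never indeterminate; infinite mean cost gives \<open>- \<infinity>\<close>
  on both sides.\<close>

lemma ext_expectation_diff:
  fixes T :: "'a \<Rightarrow> real" and C :: "'a \<Rightarrow> ennreal"
  assumes M: "prob_space M" and [measurable]: "T \<in> borel_measurable M" "C \<in> borel_measurable M"
    and B: "\<And>x. \<bar>T x\<bar> \<le> B"
  shows "ext_expectation M (\<lambda>x. ereal (T x) - enn2ereal (C x)) =
    ereal (\<integral>x. T x \<partial>M) - enn2ereal (\<integral>\<^sup>+x. C x \<partial>M)"
proof -
  interpret prob_space M by (rule M)
  let ?P = "\<integral>\<^sup>+x. e2ennreal (ereal (T x) - enn2ereal (C x)) \<partial>M"
  let ?N = "\<integral>\<^sup>+x. e2ennreal (- (ereal (T x) - enn2ereal (C x))) \<partial>M"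
  have T: "integrable M T" by (rule integrable_const_bound[where B=B]) (use B in auto)
  have "?P \<le> (\<integral>\<^sup>+x. ennreal B \<partial>M)"
  proof (rule nn_integral_mono)
    fix x
    have "ereal (T x) - enn2ereal (C x) \<le> ereal (T x) - 0"
      by (intro ereal_minus_mono) auto
    also have "\<dots> \<le> ereal B" using B[of x] by simp
    finally show "e2ennreal (ereal (T x) - enn2ereal (C x)) \<le> ennreal B"
      using e2ennreal_mono by fastforce
  qed
  then have P: "?P \<noteq> \<infinity>" by (auto simp: emeasure_space_1 top_unique)
  show ?thesis
  proof (cases "(\<integral>\<^sup>+x. C x \<partial>M) = \<infinity>")
    case True
    \<comment> \<open>Pointwise the cost exceeds the negative part by at most \<open>B\<close>, so
      infinite mean cost forces an infinite mean of the negative part.\<close>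
    have "(\<integral>\<^sup>+x. C x \<partial>M) \<le> (\<integral>\<^sup>+x. e2ennreal (- (ereal (T x) - enn2ereal (C x))) + ennreal B \<partial>M)"
    proof (rule nn_integral_mono)
      fix x
      show "C x \<le> e2ennreal (- (ereal (T x) - enn2ereal (C x))) + ennreal B"
      proof (cases "C x")
        case (real r)
        have "ennreal r \<le> ennreal (r - T x) + ennreal B"
        proof (cases "T x \<le> r")
          case True
          have "ennreal r \<le> ennreal ((r - T x) + B)" using B[of x] by (intro ennreal_leI) simp
          also have "\<dots> = ennreal (r - T x) + ennreal B"
            using True B[of x] by (intro ennreal_plus) auto
          finally show ?thesis .
        next
          case False
          then show ?thesis using B[of x] by (auto intro!: add_increasing ennreal_leI)
        qed
        then show ?thesis using real by simp
      qed simp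
    qed
    also have "\<dots> = ?N + ennreal B" by (subst nn_integral_add) (auto simp: emeasure_space_1)
    finally have "?N = \<infinity>" using True by (auto simp: top_unique)
    then show ?thesis unfolding ext_expectation_def using P True
      by (cases ?P) auto
  next
    case False
    then have fin: "AE x in M. C x \<noteq> \<infinity>" by (intro nn_integral_PInf_AE) auto
    define c where "c x = enn2real (C x)" for x
    have cn: "0 \<le> c x" for x by (simp add: c_def)
    have c: "AE x in M. C x = ennreal (c x)"
      using fin by eventually_elim (simp add: c_def less_top)
    have [measurable]: "c \<in> borel_measurable M" by (simp add: c_def[abs_def])
    have Cc: "(\<integral>\<^sup>+x. C x \<partial>M) = (\<integral>\<^sup>+x. ennreal (c x) \<partial>M)"
      by (rule nn_integral_cong_AE) (use c in auto)
    have ci: "integrable M c"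
      by (rule integrableI_nonneg) (use False cn in \<open>auto simp: Cc less_top\<close>)
    have f: "integrable M (\<lambda>x. T x - c x)" using T ci by simp
    have P': "?P = (\<integral>\<^sup>+x. ennreal (T x - c x) \<partial>M)"
      by (rule nn_integral_cong_AE) (use c in eventually_elim, simp add: cn)
    have N': "?N = (\<integral>\<^sup>+x. ennreal (- (T x - c x)) \<partial>M)"
      by (rule nn_integral_cong_AE) (use c in eventually_elim, simp add: cn)
    have fin': "?P \<noteq> \<infinity>" "?N \<noteq> \<infinity>"
      using f unfolding real_integrable_def P' N' by auto
    have "(\<integral>x. T x \<partial>M) - (\<integral>x. c x \<partial>M) = enn2real ?P - enn2real ?N"
      using real_lebesgue_integral_def[OF f] T ci unfolding P' N' by simp
    moreover have "(\<integral>\<^sup>+x. C x \<partial>M) = ennreal (\<integral>x. c x \<partial>M)"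
      unfolding Cc by (rule nn_integral_eq_integral[OF ci]) (simp add: cn)
    moreover have "0 \<le> (\<integral>x. c x \<partial>M)" by (simp add: cn)
    ultimately show ?thesis unfolding ext_expectation_def
      using fin' by (cases ?P; cases ?N) auto
  qed
qed

text \<open>Summable stakes tend to zero, while the stake at a given site is a fixed positive
  number, so each site is visited finitely often. A path with unit steps that no longer visits 0
  keeps its sign, which selects one of the two infinities.\<close>

lemma nearest_neighbour_escape:
  fixes X :: "nat \<Rightarrow> int" and a :: "int \<Rightarrow> real"
  assumes nn: "\<And>k. \<bar>X (Suc k) - X k\<bar> = 1" and a: "\<And>i. 0 < a i"
    and fin: "(\<Sum>k. ennreal (a (X k))) \<noteq> \<infinity>"
  shows "filterlim X at_top sequentially \<or> filterlim X at_bot sequentially"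
proof -
  have "summable (\<lambda>k. a (X k))"
    using fin a by (intro summable_suminf_not_top) (auto simp: less_imp_le)
  then have lim: "(\<lambda>k. a (X k)) \<longlonglongrightarrow> 0" by (rule summable_LIMSEQ_zero)
  have avoid: "\<forall>\<^sub>F k in sequentially. X k \<noteq> i" for i
    using order_tendstoD(2)[OF lim a[of i]] by eventually_elim auto
  have avoids: "\<forall>\<^sub>F k in sequentially. \<forall>i\<in>{-\<bar>Z\<bar>..\<bar>Z\<bar>}. X k \<noteq> i" for Z
    by (intro eventually_ball_finite) (auto intro: avoid)
  obtain N where N: "\<And>k. N \<le> k \<Longrightarrow> X k \<noteq> 0"
    using avoid[of 0] by (auto simp: eventually_sequentially)
  have sgn: "sgn (X (N + j)) = sgn (X N)" for j
  proof (induction j)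
    case (Suc j)
    then show ?case using nn[of "N + j"] N[of "N + j"] N[of "N + Suc j"]
      by (auto simp: sgn_if split: if_splits)
  qed simp
  show ?thesis
  proof (cases "0 < X N")
    case True
    have "\<forall>\<^sub>F k in sequentially. Z \<le> X k" for Z
      using avoids[of Z] eventually_ge_at_top[of N]
    proof eventually_elim
      case (elim k)
      then show ?case using sgn[of "k - N"] True by (force simp: sgn_if split: if_splits)
    qed
    then show ?thesis by (simp add: filterlim_at_top)
  next
    case False
    then have neg: "X N < 0" using N[of N] by simp
    have "\<forall>\<^sub>F k in sequentially. X k \<le> Z" for Z
      using avoids[of Z] eventually_ge_at_top[of N]
    proof eventually_elim
      case (elim k)
      then show ?case using sgn[of "k - N"] neg by (force simp: sgn_if split: if_splits)
    qed
    then show ?thesis by (simp add: filterlim_at_bot)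
  qed
qed

lemma not_filterlim_at_top_at_bot:
  fixes X :: "nat \<Rightarrow> int"
  assumes "filterlim X at_bot sequentially"
  shows "\<not> filterlim X at_top sequentially"
proof
  assume "filterlim X at_top sequentially"
  then have "\<forall>\<^sub>F k in sequentially. 1 \<le> X k \<and> X k \<le> 0"
    using assms by (simp add: filterlim_at_top filterlim_at_bot eventually_conj)
  then show False by (auto simp: eventually_sequentially)
qed

text \<open>Boundary data are limits along the naturals, whereas composing with a diverging counter
  requires limits along filters on the integers.\<close>

lemma tendsto_int_at_top:
  fixes u :: "int \<Rightarrow> 'a::topological_space"
  assumes "(\<lambda>k. u (int k)) \<longlonglongrightarrow> v"
  shows "(u \<longlongrightarrow> v) at_top"
proof (rule Lim_transform_eventually)
  show "((\<lambda>x. u (int (nat x))) \<longlongrightarrow> v) at_top"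
    by (rule filterlim_compose[OF assms filterlim_nat_sequentially])
  show "\<forall>\<^sub>F x in at_top. u (int (nat x)) = u x"
    using eventually_ge_at_top[of "0::int"] by eventually_elim simp
qed

lemma tendsto_int_at_bot:
  fixes u :: "int \<Rightarrow> 'a::topological_space"
  assumes "(\<lambda>k. u (- int k)) \<longlonglongrightarrow> v"
  shows "(u \<longlongrightarrow> v) at_bot"
proof -
  have "((\<lambda>x. u (- x)) \<longlongrightarrow> v) at_top"
    by (rule tendsto_int_at_top) (use assms in simp)
  moreover have "filterlim (\<lambda>x::int. - x) at_top at_bot"
  proof -
    have "\<forall>\<^sub>F x in at_bot. Z \<le> - x" for Z :: int
      using eventually_le_at_bot[of "-Z"] by eventually_elim simp
    then show ?thesis by (simp add: filterlim_at_top)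
  qed
  ultimately have "((\<lambda>x. u (- (- x))) \<longlongrightarrow> v) at_bot"
    by (rule filterlim_compose)
  then show ?thesis by simp
qed

section \<open>Terminal receipts, mean costs and payoffs\<close>

lemma terminal_receipt_bounded: "\<bar>terminal_receipt u v w X\<bar> \<le> \<bar>u\<bar> + \<bar>v\<bar> + \<bar>w\<bar>"
  by (simp add: terminal_receipt_def)

lemma terminal_receipt_case_nat [simp]:
  "terminal_receipt u v w (case_nat l X) = terminal_receipt u v w X"
  using filterlim_sequentially_Suc[of "case_nat l X"] by (simp add: terminal_receipt_def)

lemma running_cost_case_nat:
  "running_cost S (case_nat l X) = ennreal (S [l]) + running_cost (\<lambda>\<psi>. S (l # \<psi>)) X"
  unfolding running_cost_def by (subst suminf_offset[where i=1]) simp_all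

context trail_of_lost_pennies
begin

definition mean_terminal :: "real \<Rightarrow> real \<Rightarrow> real \<Rightarrow> strategy \<Rightarrow> strategy \<Rightarrow> int \<Rightarrow> real" where
  "mean_terminal u v w S\<^sub>m S\<^sub>p l = (\<integral>X. terminal_receipt u v w X \<partial>law S\<^sub>m S\<^sub>p l)"

text \<open>The first strategy is the one whose stakes are charged, the other two govern play. With
  this convention \<open>payoff\<close> serves both players, and a drift function can be charged as
  if it were a stake.\<close>

definition mean_cost :: "strategy \<Rightarrow> strategy \<Rightarrow> strategy \<Rightarrow> int \<Rightarrow> ennreal" where
  "mean_cost S S\<^sub>m S\<^sub>p l = (\<integral>\<^sup>+X. running_cost S X \<partial>law S\<^sub>m S\<^sub>p l)"

definition payoff :: "real \<Rightarrow> real \<Rightarrow> real \<Rightarrow> strategy \<Rightarrow> strategy \<Rightarrow> strategy \<Rightarrow> int \<Rightarrow> ereal" where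
  "payoff u v w S S\<^sub>m S\<^sub>p l = ext_expectation (law S\<^sub>m S\<^sub>p l) (net_receipt u v w S)"

lemma integrable_terminal_receipt: "integrable (law S\<^sub>m S\<^sub>p l) (terminal_receipt u v w)"
proof -
  interpret prob_space "law S\<^sub>m S\<^sub>p l" by (rule prob_space_play_law)
  show ?thesis
    by (rule integrable_const_bound[where B="\<bar>u\<bar> + \<bar>v\<bar> + \<bar>w\<bar>"]) (auto simp: terminal_receipt_bounded)
qed

lemma payoff_eq: "payoff u v w S S\<^sub>m S\<^sub>p l = ereal (mean_terminal u v w S\<^sub>m S\<^sub>p l) - enn2ereal (mean_cost S S\<^sub>m S\<^sub>p l)"
  unfolding payoff_def net_receipt_def[abs_def] mean_terminal_def mean_cost_def
  by (rule ext_expectation_diff[OF prob_space_play_law]) (auto intro: terminal_receipt_bounded)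

lemma mean_terminal_bounds:
  assumes "L \<le> u" "L \<le> v" "L \<le> w" "u \<le> H" "v \<le> H" "w \<le> H"
  shows "L \<le> mean_terminal u v w S\<^sub>m S\<^sub>p l" "mean_terminal u v w S\<^sub>m S\<^sub>p l \<le> H"
proof -
  interpret prob_space "law S\<^sub>m S\<^sub>p l" by (rule prob_space_play_law)
  have "L \<le> terminal_receipt u v w X" "terminal_receipt u v w X \<le> H" for X
    using assms by (auto simp: terminal_receipt_def)
  then show "L \<le> mean_terminal u v w S\<^sub>m S\<^sub>p l" "mean_terminal u v w S\<^sub>m S\<^sub>p l \<le> H"
    unfolding mean_terminal_def by (auto intro!: integral_ge_const integral_le_const integrable_terminal_receipt)
qed

lemma nn_integral_terminal_receipt:
  assumes "c \<le> u" "c \<le> v" "c \<le> w"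
  shows "(\<integral>\<^sup>+X. ennreal (terminal_receipt u v w X - c) \<partial>law S\<^sub>m S\<^sub>p l) = ennreal (mean_terminal u v w S\<^sub>m S\<^sub>p l - c)"
proof -
  interpret prob_space "law S\<^sub>m S\<^sub>p l" by (rule prob_space_play_law)
  have "0 \<le> terminal_receipt u v w X - c" for X using assms by (simp add: terminal_receipt_def)
  then have "(\<integral>\<^sup>+X. ennreal (terminal_receipt u v w X - c) \<partial>law S\<^sub>m S\<^sub>p l) =
      ennreal (\<integral>X. terminal_receipt u v w X - c \<partial>law S\<^sub>m S\<^sub>p l)"
    by (intro nn_integral_eq_integral) (auto simp: integrable_terminal_receipt)
  also have "(\<integral>X. terminal_receipt u v w X - c \<partial>law S\<^sub>m S\<^sub>p l) = mean_terminal u v w S\<^sub>m S\<^sub>p l - c"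
    unfolding mean_terminal_def using prob_space
    by (simp add: integrable_terminal_receipt)
  finally show ?thesis .
qed

lemma payoff_finite_iff:
  "payoff u v w S S\<^sub>m S\<^sub>p l = ereal x \<longleftrightarrow>
    mean_cost S S\<^sub>m S\<^sub>p l \<noteq> \<infinity> \<and> x = mean_terminal u v w S\<^sub>m S\<^sub>p l - enn2real (mean_cost S S\<^sub>m S\<^sub>p l)"
  unfolding payoff_eq by (cases "mean_cost S S\<^sub>m S\<^sub>p l") auto

text \<open>First-step analysis of the payoff, the primed strategies describing the continuation.
  Terminal receipt and cost are decomposed separately, since the payoff itself is signed.\<close>

lemma payoff_step:
  assumes agree: "\<And>y \<psi>. \<bar>y - l\<bar> = 1 \<Longrightarrow> \<psi> \<in> paths_from y \<Longrightarrow> S\<^sub>m (l # \<psi>) = S\<^sub>m' \<psi>"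
    "\<And>y \<psi>. \<bar>y - l\<bar> = 1 \<Longrightarrow> \<psi> \<in> paths_from y \<Longrightarrow> S\<^sub>p (l # \<psi>) = S\<^sub>p' \<psi>"
    "\<And>y \<psi>. \<bar>y - l\<bar> = 1 \<Longrightarrow> \<psi> \<in> paths_from y \<Longrightarrow> S (l # \<psi>) = S' \<psi>"
    and S: "0 \<le> S [l]"
    and x: "payoff u v w S' S\<^sub>m' S\<^sub>p' (l + 1) = ereal x" and y: "payoff u v w S' S\<^sub>m' S\<^sub>p' (l - 1) = ereal y"
  shows "payoff u v w S S\<^sub>m S\<^sub>p l =
    ereal (up (S\<^sub>m [l]) (S\<^sub>p [l]) * x + (1 - up (S\<^sub>m [l]) (S\<^sub>p [l])) * y - S [l])"
proof -
  define p where "p = up (S\<^sub>m [l]) (S\<^sub>p [l])"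
  have p: "0 \<le> p" "p \<le> 1" using up_bounds by (auto simp: p_def)
  define c where "c = min u (min v w)"
  have c: "c \<le> u" "c \<le> v" "c \<le> w" by (auto simp: c_def)
  note law_step = nn_integral_law_step[where l=l and S\<^sub>m=S\<^sub>m and S\<^sub>p=S\<^sub>p and S\<^sub>m'=S\<^sub>m' and S\<^sub>p'=S\<^sub>p',
      OF _ agree(1,2)]
  let ?e = "mean_terminal u v w S\<^sub>m' S\<^sub>p'"
  have e: "mean_terminal u v w S\<^sub>m S\<^sub>p l = p * ?e (l + 1) + (1 - p) * ?e (l - 1)"
  proof -
    have ge: "0 \<le> mean_terminal u v w S\<^sub>m S\<^sub>p l - c" for S\<^sub>m S\<^sub>p l
      using mean_terminal_bounds(1)[OF c, of "max u (max v w)"] by simp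
    have "ennreal (mean_terminal u v w S\<^sub>m S\<^sub>p l - c) =
        ennreal p * ennreal (?e (l + 1) - c) + ennreal (1 - p) * ennreal (?e (l - 1) - c)"
      unfolding nn_integral_terminal_receipt[OF c, symmetric]
      by (subst law_step) (simp_all add: p_def)
    also have "\<dots> = ennreal (p * (?e (l + 1) - c) + (1 - p) * (?e (l - 1) - c))"
      using p ge by (subst ennreal_plus) (simp_all add: ennreal_mult)
    finally have "mean_terminal u v w S\<^sub>m S\<^sub>p l - c = p * (?e (l + 1) - c) + (1 - p) * (?e (l - 1) - c)"
      using p ge by (subst (asm) ennreal_inj) auto
    then show ?thesis by (simp add: algebra_simps)
  qed
  let ?c = "mean_cost S' S\<^sub>m' S\<^sub>p'"
  have shift: "(\<integral>\<^sup>+X. running_cost S (case_nat l X) \<partial>law S\<^sub>m' S\<^sub>p' z) = ennreal (S [l]) + ?c z"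
    if z: "\<bar>z - l\<bar> = 1" for z
  proof -
    have "(\<integral>\<^sup>+X. running_cost (\<lambda>\<psi>. S (l # \<psi>)) X \<partial>law S\<^sub>m' S\<^sub>p' z) = ?c z"
      unfolding mean_cost_def
    proof (rule nn_integral_cong_AE)
      show "AE X in law S\<^sub>m' S\<^sub>p' z. running_cost (\<lambda>\<psi>. S (l # \<psi>)) X = running_cost S' X"
        using AE_history_paths_from
        by eventually_elim (simp add: running_cost_def agree(3)[OF z])
    qed
    then show ?thesis by (simp add: running_cost_case_nat nn_integral_add)
  qed
  have fin: "?c (l + 1) \<noteq> \<infinity>" "?c (l - 1) \<noteq> \<infinity>"
    and xy: "x = ?e (l + 1) - enn2real (?c (l + 1))" "y = ?e (l - 1) - enn2real (?c (l - 1))"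
    using x y by (simp_all add: payoff_finite_iff)
  have "mean_cost S S\<^sub>m S\<^sub>p l =
      ennreal p * (ennreal (S [l]) + ?c (l + 1)) + ennreal (1 - p) * (ennreal (S [l]) + ?c (l - 1))"
    unfolding mean_cost_def[of S S\<^sub>m]
    by (subst law_step) (simp_all add: shift p_def)
  also have "\<dots> = ennreal (p * (S [l] + enn2real (?c (l + 1))) + (1 - p) * (S [l] + enn2real (?c (l - 1))))"
  proof -
    obtain s t where st: "?c (l + 1) = ennreal s" "?c (l - 1) = ennreal t" "0 \<le> s" "0 \<le> t"
      using fin by (cases "?c (l + 1)"; cases "?c (l - 1)") auto
    have "ennreal p * ennreal (S [l] + s) + ennreal (1 - p) * ennreal (S [l] + t) =
        ennreal (p * (S [l] + s) + (1 - p) * (S [l] + t))"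
      using p S st by (subst ennreal_plus) (simp_all add: ennreal_mult del: ennreal_plus)
    then show ?thesis using S st by simp
  qed
  finally have "mean_cost S S\<^sub>m S\<^sub>p l = \<dots>" .
  moreover have "0 \<le> p * (S [l] + enn2real (?c (l + 1))) + (1 - p) * (S [l] + enn2real (?c (l - 1)))"
    using p S by simp
  ultimately show ?thesis
    unfolding payoff_finite_iff e xy p_def[symmetric] by (simp add: algebra_simps)
qed

section \<open>Supermartingale bounds and martingale limits\<close>

lemma partial_cost_tendsto:
  "(\<lambda>k. \<integral>\<^sup>+X. (\<Sum>j<k. ennreal (S (history X j))) \<partial>law S\<^sub>m S\<^sub>p l) \<longlonglongrightarrow> mean_cost S S\<^sub>m S\<^sub>p l"
proof -
  have "mean_cost S S\<^sub>m S\<^sub>p l = (\<Sum>j. \<integral>\<^sup>+X. ennreal (S (history X j)) \<partial>law S\<^sub>m S\<^sub>p l)"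
    unfolding mean_cost_def running_cost_def by (rule nn_integral_suminf) simp
  then show ?thesis by (simp add: nn_integral_sum summable_LIMSEQ)
qed

lemma partial_cost_le: "(\<integral>\<^sup>+X. (\<Sum>j<k. ennreal (S (history X j))) \<partial>law S\<^sub>m S\<^sub>p l) \<le> mean_cost S S\<^sub>m S\<^sub>p l"
  unfolding mean_cost_def running_cost_def by (intro nn_integral_mono sum_le_suminf) auto

text \<open>\<open>f (X k)\<close> minus the running cost is a supermartingale, and Fatou's lemma
  passes to the limit for \<open>f - w\<close>. On escape the integrand converges to the receipt
  minus \<open>w\<close>; without escape the receipt is \<open>w\<close> itself, so the lower limit
  still dominates.\<close>

lemma payoff_le_supermartingale:
  assumes S: "\<And>\<psi>. \<psi> \<in> paths_from l \<Longrightarrow> 0 \<le> S \<psi>"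
    and step: "\<And>\<psi>. \<psi> \<in> paths_from l \<Longrightarrow>
      up (S\<^sub>m \<psi>) (S\<^sub>p \<psi>) * f (last \<psi> + 1) + (1 - up (S\<^sub>m \<psi>) (S\<^sub>p \<psi>)) * f (last \<psi> - 1) \<le> f (last \<psi>) + S \<psi>"
    and w: "\<And>i. w \<le> f i" and lim: "(f \<longlongrightarrow> v) at_top" "(f \<longlongrightarrow> u) at_bot"
  shows "payoff u v w S S\<^sub>m S\<^sub>p l \<le> ereal (f l)"
proof -
  \<comment> \<open>\<open>D\<close> is the mean one-turn loss of the supermartingale; adding it
    turns the inequality into the identity required by \<open>expectation_telescope\<close>.\<close>
  define D where "D \<psi> = f (last \<psi>) + S \<psi> -
      (up (S\<^sub>m \<psi>) (S\<^sub>p \<psi>) * f (last \<psi> + 1) + (1 - up (S\<^sub>m \<psi>) (S\<^sub>p \<psi>)) * f (last \<psi> - 1))" for \<psi>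
  have wu: "w \<le> u" "w \<le> v"
    using tendsto_lowerbound[OF lim(2)] tendsto_lowerbound[OF lim(1)] w by simp_all
  have bound: "(\<integral>\<^sup>+X. ennreal (f (X k) - w) \<partial>law S\<^sub>m S\<^sub>p l) \<le> ennreal (f l - w) + mean_cost S S\<^sub>m S\<^sub>p l" for k
  proof -
    have "(\<integral>\<^sup>+X. ennreal (f (X k) - w) \<partial>law S\<^sub>m S\<^sub>p l) \<le>
        ennreal (f l - w) + (\<integral>\<^sup>+X. (\<Sum>j<k. ennreal (S (history X j))) \<partial>law S\<^sub>m S\<^sub>p l)"
      by (subst expectation_telescope[symmetric, where D=D])
         (use w S step in \<open>auto simp: D_def\<close>)
    also have "\<dots> \<le> ennreal (f l - w) + mean_cost S S\<^sub>m S\<^sub>p l"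
      by (intro add_left_mono partial_cost_le)
    finally show ?thesis .
  qed
  have "ennreal (mean_terminal u v w S\<^sub>m S\<^sub>p l - w) =
      (\<integral>\<^sup>+X. ennreal (terminal_receipt u v w X - w) \<partial>law S\<^sub>m S\<^sub>p l)"
    using wu by (simp add: nn_integral_terminal_receipt)
  also have "\<dots> \<le> (\<integral>\<^sup>+X. liminf (\<lambda>k. ennreal (f (X k) - w)) \<partial>law S\<^sub>m S\<^sub>p l)"
  proof (rule nn_integral_mono)
    fix X
    have *: "ennreal (z - w) \<le> liminf (\<lambda>k. ennreal (f (X k) - w))" if "(\<lambda>k. f (X k)) \<longlonglongrightarrow> z" for z
    proof -
      have "liminf (\<lambda>k. ennreal (f (X k) - w)) = ennreal (z - w)"
        by (rule lim_imp_Liminf) (use that in \<open>auto intro!: tendsto_intros\<close>)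
      then show ?thesis by simp
    qed
    show "ennreal (terminal_receipt u v w X - w) \<le> liminf (\<lambda>k. ennreal (f (X k) - w))"
      using *[OF filterlim_compose[OF lim(1)]] *[OF filterlim_compose[OF lim(2)]]
      by (auto simp: terminal_receipt_def)
  qed
  also have "\<dots> \<le> liminf (\<lambda>k. \<integral>\<^sup>+X. ennreal (f (X k) - w) \<partial>law S\<^sub>m S\<^sub>p l)"
    by (rule nn_integral_liminf) simp
  also have "\<dots> \<le> limsup (\<lambda>k. \<integral>\<^sup>+X. ennreal (f (X k) - w) \<partial>law S\<^sub>m S\<^sub>p l)"
    by (rule Liminf_le_Limsup) simp
  also have "\<dots> \<le> ennreal (f l - w) + mean_cost S S\<^sub>m S\<^sub>p l"
    by (rule Limsup_bounded) (simp add: bound)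
  finally have le: "ennreal (mean_terminal u v w S\<^sub>m S\<^sub>p l - w) \<le> ennreal (f l - w) + mean_cost S S\<^sub>m S\<^sub>p l" .
  show ?thesis
  proof (cases "mean_cost S S\<^sub>m S\<^sub>p l")
    case (real r)
    have "ennreal (f l - w) + ennreal r = ennreal (f l - w + r)"
      using w[of l] real by (intro ennreal_plus[symmetric]) auto
    then have "ennreal (mean_terminal u v w S\<^sub>m S\<^sub>p l - w) \<le> ennreal (f l - w + r)"
      using le unfolding real by metis
    then have "mean_terminal u v w S\<^sub>m S\<^sub>p l - w \<le> f l - w + r"
      using real w[of l] by (subst (asm) ennreal_le_iff) auto
    then show ?thesis using real unfolding payoff_eq by simp
  qed (simp add: payoff_eq)
qed

text \<open>Boundedness of \<open>f\<close> bounds the mean cost through the telescoped identity, so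
  the total cost is almost surely finite and positive stakes force escape. Dominated convergence
  then identifies the limit of the mean of \<open>f (X k)\<close> with the mean terminal
  receipt.\<close>

lemma martingale_limit:
  assumes S: "\<And>\<psi>. \<psi> \<in> paths_from l \<Longrightarrow> S \<psi> = a (last \<psi>)" and a: "\<And>i. 0 < a i"
    and step: "\<And>\<psi>. \<psi> \<in> paths_from l \<Longrightarrow>
      f (last \<psi>) + S \<psi> = up (S\<^sub>m \<psi>) (S\<^sub>p \<psi>) * f (last \<psi> + 1) + (1 - up (S\<^sub>m \<psi>) (S\<^sub>p \<psi>)) * f (last \<psi> - 1)"
    and bounds: "\<And>i. c \<le> f i" "\<And>i. f i \<le> H" and lim: "(f \<longlongrightarrow> v) at_top" "(f \<longlongrightarrow> u) at_bot"
  shows "AE X in law S\<^sub>m S\<^sub>p l. filterlim X at_top sequentially \<or> filterlim X at_bot sequentially"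
    and "payoff u v w S S\<^sub>m S\<^sub>p l = ereal (f l)"
proof -
  let ?C = "\<lambda>k. \<integral>\<^sup>+X. (\<Sum>j<k. ennreal (S (history X j))) \<partial>law S\<^sub>m S\<^sub>p l"
  \<comment> \<open>\<open>d\<close> bounds \<open>f\<close> and \<open>w\<close> from below, hence
    also the limits \<open>u\<close> and \<open>v\<close>, so all shifted integrands are
    nonnegative.\<close>
  define d where "d = min c w"
  have d: "d \<le> f i" for i using bounds(1)[of i] by (auto simp: d_def)
  have dw: "d \<le> w" by (simp add: d_def)
  have uv: "d \<le> u" "d \<le> v"
    using tendsto_lowerbound[OF lim(2)] tendsto_lowerbound[OF lim(1)] d by simp_all
  have tel: "(\<integral>\<^sup>+X. ennreal (f (X k) - d) \<partial>law S\<^sub>m S\<^sub>p l) = ennreal (f l - d) + ?C k" for k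
    using expectation_telescope[where c=d and u=f and l=l and S=S and D="\<lambda>_. 0" and S\<^sub>m=S\<^sub>m and S\<^sub>p=S\<^sub>p and k=k] d S a step by (auto simp: less_imp_le)
  have "?C k \<le> ennreal (H - d)" for k
  proof -
    have "?C k \<le> (\<integral>\<^sup>+X. ennreal (f (X k) - d) \<partial>law S\<^sub>m S\<^sub>p l)" unfolding tel by simp
    also have "\<dots> \<le> (\<integral>\<^sup>+X. ennreal (H - d) \<partial>law S\<^sub>m S\<^sub>p l)"
      using bounds by (intro nn_integral_mono ennreal_leI) simp
    finally show ?thesis by simp
  qed
  then have "mean_cost S S\<^sub>m S\<^sub>p l \<le> ennreal (H - d)"
    by (intro tendsto_upperbound[OF partial_cost_tendsto]) auto
  then have fin: "mean_cost S S\<^sub>m S\<^sub>p l \<noteq> \<infinity>" by (auto simp: top_unique)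
  then have "AE X in law S\<^sub>m S\<^sub>p l. running_cost S X \<noteq> \<infinity>"
    unfolding mean_cost_def by (intro nn_integral_PInf_AE) simp_all
  then show esc: "AE X in law S\<^sub>m S\<^sub>p l. filterlim X at_top sequentially \<or> filterlim X at_bot sequentially"
    using AE_history_paths_from AE_nearest_neighbour
  proof eventually_elim
    case (elim X)
    then show ?case
      by (intro nearest_neighbour_escape[of X a]) (auto simp: a running_cost_def S)
  qed
  have "(\<lambda>k. \<integral>\<^sup>+X. ennreal (f (X k) - d) \<partial>law S\<^sub>m S\<^sub>p l) \<longlonglongrightarrow>
      (\<integral>\<^sup>+X. ennreal (terminal_receipt u v w X - d) \<partial>law S\<^sub>m S\<^sub>p l)"
  proof (rule nn_integral_dominated_convergence[where w="\<lambda>_. ennreal (H - d)"])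
    show "AE X in law S\<^sub>m S\<^sub>p l. (\<lambda>k. ennreal (f (X k) - d)) \<longlonglongrightarrow> ennreal (terminal_receipt u v w X - d)"
      using esc
    proof eventually_elim
      case (elim X)
      then have "(\<lambda>k. f (X k)) \<longlonglongrightarrow> terminal_receipt u v w X"
        using filterlim_compose[OF lim(1)] filterlim_compose[OF lim(2)] not_filterlim_at_top_at_bot[of X]
        by (auto simp: terminal_receipt_def)
      then show ?case by (auto intro!: tendsto_intros)
    qed
    show "AE X in law S\<^sub>m S\<^sub>p l. ennreal (f (X k) - d) \<le> ennreal (H - d)" for k
      using bounds by (auto intro!: ennreal_leI)
  qed auto
  moreover have "(\<lambda>k. \<integral>\<^sup>+X. ennreal (f (X k) - d) \<partial>law S\<^sub>m S\<^sub>p l) \<longlonglongrightarrow> ennreal (f l - d) + mean_cost S S\<^sub>m S\<^sub>p l"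
    unfolding tel by (intro tendsto_intros partial_cost_tendsto)
  ultimately have "ennreal (mean_terminal u v w S\<^sub>m S\<^sub>p l - d) = ennreal (f l - d) + mean_cost S S\<^sub>m S\<^sub>p l"
    using uv dw LIMSEQ_unique by (simp add: nn_integral_terminal_receipt)
  moreover have "d \<le> mean_terminal u v w S\<^sub>m S\<^sub>p l"
    by (rule mean_terminal_bounds(1)[where H="max u (max v w)"]) (use uv dw in auto)
  ultimately show "payoff u v w S S\<^sub>m S\<^sub>p l = ereal (f l)"
    using fin d[of l] unfolding payoff_finite_iff
    by (cases "mean_cost S S\<^sub>m S\<^sub>p l")
       (auto simp: ennreal_plus[symmetric] simp del: ennreal_plus)
qed

end

text \<open>The stake equations compare values two sites apart, so monotonicity is used within a
  parity class; each class still runs to both infinities and has the same two limits.\<close>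

lemma two_step_mono_bounds:
  fixes f :: "int \<Rightarrow> real"
  assumes mono: "\<And>i. f (i - 1) \<le> f (i + 1)" and lim: "(f \<longlongrightarrow> v) at_top" "(f \<longlongrightarrow> u) at_bot"
  shows "u \<le> f i" "f i \<le> v"
proof -
  have step: "f j \<le> f (j + 2)" for j using mono[of "j + 1"] by (simp add: add.commute)
  have up: "f i \<le> f (i + 2 * int k)" for k
  proof (induction k)
    case (Suc k)
    then show ?case using step[of "i + 2 * int k"] by (simp add: algebra_simps)
  qed simp
  have down: "f (i - 2 * int k) \<le> f i" for k
  proof (induction k)
    case (Suc k)
    then show ?case using step[of "i - 2 * int (Suc k)"] by (simp add: algebra_simps)
  qed simp
  have 1: "filterlim (\<lambda>k. i + 2 * int k) at_top sequentially"
  proof (subst filterlim_at_top, intro allI)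
    fix Z show "\<forall>\<^sub>F k in sequentially. Z \<le> i + 2 * int k"
      using eventually_ge_at_top[of "nat \<bar>Z - i\<bar>"] by eventually_elim linarith
  qed
  have 2: "filterlim (\<lambda>k. i - 2 * int k) at_bot sequentially"
  proof (subst filterlim_at_bot, intro allI)
    fix Z show "\<forall>\<^sub>F k in sequentially. i - 2 * int k \<le> Z"
      using eventually_ge_at_top[of "nat \<bar>Z - i\<bar>"] by eventually_elim linarith
  qed
  show "f i \<le> v"
    by (rule tendsto_lowerbound[OF filterlim_compose[OF lim(1) 1]]) (use up in auto)
  show "u \<le> f i"
    by (rule tendsto_upperbound[OF filterlim_compose[OF lim(2) 2]]) (use down in auto)
qed

lemma bounded_mono_int_limits:
  fixes f :: "int \<Rightarrow> real"
  assumes mono: "\<And>i. f i \<le> f (i + 1)" and bounds: "\<And>i. c \<le> f i" "\<And>i. f i \<le> H"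
  obtains u v where "(\<lambda>k. f (int k)) \<longlonglongrightarrow> v" "(\<lambda>k. f (- int k)) \<longlonglongrightarrow> u"
    "\<And>i. u \<le> f i" "\<And>i. f i \<le> v"
proof -
  have inc: "incseq (\<lambda>k. f (int k))"
    using mono by (intro incseq_SucI) (metis of_nat_Suc add.commute)
  have dec: "decseq (\<lambda>k. f (- int k))"
  proof (rule decseq_SucI)
    fix k show "f (- int (Suc k)) \<le> f (- int k)" using mono[of "- int (Suc k)"] by simp
  qed
  obtain v where v: "(\<lambda>k. f (int k)) \<longlonglongrightarrow> v"
    using incseq_convergent[OF inc] bounds by metis
  obtain u where u: "(\<lambda>k. f (- int k)) \<longlonglongrightarrow> u"
    using decseq_convergent[OF dec] bounds by metis
  have "f (i - 1) \<le> f (i + 1)" for i using mono[of "i - 1"] mono[of i] by simp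
  from two_step_mono_bounds[OF this tendsto_int_at_top[OF v] tendsto_int_at_bot[OF u]] that[OF v u]
  show thesis by blast
qed

section \<open>Optimal stakes\<close>

context trail_of_lost_pennies
begin

section \<open>Symmetry and monotonicity of the chance to win\<close>

lemma stake_win_prob_swap:
  "stake_win_prob \<rho> b a = 1 - stake_win_prob \<rho> a b"
proof (cases "a = 0 \<and> b = 0")
  case False
  then have "0 < a powr \<rho> + b powr \<rho>"
    by (cases "a = 0") (auto intro: add_pos_nonneg add_nonneg_pos)
  then have "a powr \<rho> / (a powr \<rho> + b powr \<rho>) + b powr \<rho> / (a powr \<rho> + b powr \<rho>) = 1"
    by (simp add: add_divide_distrib[symmetric])
  then show ?thesis using False by (auto simp: stake_win_prob_def add.commute)
qed (simp add: stake_win_prob_def)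

text \<open>Reflection of the line exchanges the players; through this identity Mina's optimisation
  becomes Maxine's with stakes and neighbours exchanged.\<close>

lemma up_swap: "up b a = 1 - up a b"
  unfolding up_prob_def by (subst stake_win_prob_swap) (simp add: field_simps)

lemma up_zero: "0 < a \<Longrightarrow> up 0 a = (1 + \<kappa>) / 2" "up 0 0 = 1 / 2"
  by (auto simp: up_prob_def stake_win_prob_def field_simps)

lemma up_ge_up_zero:
  assumes "0 \<le> b" "0 \<le> a"
  shows "up b 0 \<le> up b a"
proof -
  have "stake_win_prob \<rho> b 0 \<le> stake_win_prob \<rho> b a"
    using assms by (cases "b = 0"; cases "a = 0") (auto simp: stake_win_prob_def)
  then show ?thesis using \<kappa> by (simp add: up_prob_def mult_left_mono)
qed

text \<open>Mean return of one turn to a player staking \<open>s\<close> against \<open>b\<close>,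
  when \<open>x\<close> and \<open>y\<close> are the values of continuing after a step in the
  player's favour and against it. For Mina the favourable neighbour is the left one.\<close>

definition stake_value :: "real \<Rightarrow> real \<Rightarrow> real \<Rightarrow> real \<Rightarrow> real" where
  "stake_value x y b s = up b s * x + (1 - up b s) * y - s"

lemma stake_value_altdef: "stake_value x y b s = y + up b s * (x - y) - s"
  by (simp add: stake_value_def algebra_simps)

lemma up_eq:
  assumes "0 < b" "0 \<le> s"
  shows "up b s = (1 + \<kappa>) / 2 - \<kappa> * b powr \<rho> / (b powr \<rho> + s powr \<rho>)"
proof -
  have "0 < b powr \<rho> + s powr \<rho>" using assms by (simp add: add_pos_nonneg)
  then show ?thesis using assms by (simp add: up_prob_def stake_win_prob_def field_simps)
qed

lemma DERIV_stake_value: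
  assumes b: "0 < b" and s: "0 < s"
  shows "(stake_value x y b has_real_derivative
    \<rho> * \<kappa> * s powr (\<rho> - 1) * b powr \<rho> * (x - y) / (s powr \<rho> + b powr \<rho>)\<^sup>2 - 1) (at s)"
proof -
  have pos: "0 < b powr \<rho> + s powr \<rho>" using assms by (simp add: add_pos_nonneg)
  have "((\<lambda>s. y + ((1 + \<kappa>) / 2 - \<kappa> * b powr \<rho> / (b powr \<rho> + s powr \<rho>)) * (x - y) - s)
    has_real_derivative
    \<rho> * \<kappa> * s powr (\<rho> - 1) * b powr \<rho> * (x - y) / (s powr \<rho> + b powr \<rho>)\<^sup>2 - 1) (at s)"
    using pos s by (auto intro!: derivative_eq_intros simp: power2_eq_square add.commute)
  \<comment> \<open>The closed form is available for nonnegative stakes, and a neighbourhood of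
    \<open>s\<close> inside the positive half-line suffices for the derivative.\<close>
  moreover have "\<forall>\<^sub>F t in nhds s. y + ((1 + \<kappa>) / 2 - \<kappa> * b powr \<rho> / (b powr \<rho> + t powr \<rho>)) * (x - y) - t = stake_value x y b t"
    using eventually_nhds_in_open[of "{0<..}" s, OF open_greaterThan] s
    by (simp, elim eventually_mono) (simp add: stake_value_altdef up_eq[OF b])
  ultimately show ?thesis
    by (subst (asm) DERIV_cong_ev[OF refl _ refl]) auto
qed

text \<open>Since \<open>\<rho> \<le> 1\<close>, the marginal return is nonincreasing in the stake.
  It vanishes at \<open>a\<close> by the critical equation, so the value is nondecreasing up to
  \<open>a\<close> and nonincreasing after it. Stake zero lies outside the range of the derivative
  formula and is reached by approximation.\<close>

lemma stake_value_le:
  assumes b: "0 < b" and a: "0 < a" and s: "0 \<le> s"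
    and crit: "(a powr \<rho> + b powr \<rho>)\<^sup>2 = \<rho> * \<kappa> * a powr (\<rho> - 1) * b powr \<rho> * (x - y)"
  shows "y < x" "stake_value x y b s \<le> stake_value x y b a"
proof -
  let ?D = "\<lambda>t. \<rho> * \<kappa> * t powr (\<rho> - 1) * b powr \<rho> * (x - y) / (t powr \<rho> + b powr \<rho>)\<^sup>2 - 1"
  have sq: "0 < (t powr \<rho> + b powr \<rho>)\<^sup>2" if "0 < t" for t
    using that by (intro zero_less_power add_pos_nonneg) auto
  have "0 < \<rho> * \<kappa> * a powr (\<rho> - 1) * b powr \<rho>" using a b \<rho> \<kappa> by simp
  then have "0 < x - y" using sq[OF a] unfolding crit by (rule zero_less_mult_pos[rotated])
  then show xy: "y < x" by simp
  have crit': "?D a = 0"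
    using sq[OF a] unfolding crit[symmetric] by simp
  \<comment> \<open>The numerator carries \<open>t powr (\<rho> - 1)\<close>, nonincreasing by
    \<open>\<rho> \<le> 1\<close>, and the denominator grows with \<open>t\<close>.\<close>
  have anti: "?D t \<le> ?D t'" if "0 < t'" "t' \<le> t" for t t'
  proof -
    have "t powr (\<rho> - 1) \<le> t' powr (\<rho> - 1)" using that \<rho> by (intro powr_mono2') auto
    moreover have "(t' powr \<rho> + b powr \<rho>)\<^sup>2 \<le> (t powr \<rho> + b powr \<rho>)\<^sup>2"
      using that \<rho> by (intro power_mono add_right_mono powr_mono2) auto
    moreover note sq[OF that(1)]
    ultimately show ?thesis
      using \<rho> \<kappa> xy by (intro diff_right_mono frac_le mult_right_mono mult_left_mono mult_nonneg_nonneg) auto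
  qed
  have pos: "stake_value x y b s \<le> stake_value x y b a" if s: "0 < s" for s
  proof (cases "s \<le> a")
    case True
    show ?thesis
      by (rule DERIV_nonneg_imp_nondecreasing[OF True], intro exI conjI, rule DERIV_stake_value[OF b])
         (use s anti[of _ a] crit' in fastforce)+
  next
    case False
    then have "a \<le> s" by simp
    then show ?thesis
      by (rule DERIV_nonpos_imp_nonincreasing, intro exI conjI, rule_tac DERIV_stake_value[OF b])
         (use a anti[of a] crit' in fastforce)+
  qed
  show "stake_value x y b s \<le> stake_value x y b a"
  proof (cases "s = 0")
    case True
    \<comment> \<open>Compared with stake 0, a stake \<open>e\<close> never lowers the chance of
      winning, so it loses at most \<open>e\<close>; then \<open>e\<close> tends to 0.\<close>
    have "stake_value x y b 0 \<le> stake_value x y b a + e" if "0 < e" for e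
    proof -
      have "up b 0 * (x - y) \<le> up b e * (x - y)"
        using up_ge_up_zero[of b e] b that xy by (intro mult_right_mono) auto
      then show ?thesis using pos[OF that] by (simp add: stake_value_altdef)
    qed
    then show ?thesis using True by (simp add: field_le_epsilon)
  qed (use pos s in simp)
qed

section \<open>Consequences of optimality at one site\<close>

lemma optimal_stake_zero:
  assumes "0 \<le> b" "0 \<le> a" and max: "\<And>s. 0 \<le> s \<Longrightarrow> stake_value x y b s \<le> stake_value x y b a"
    and "x \<le> y"
  shows "a = 0"
proof -
  have "up b a * (x - y) \<le> up b 0 * (x - y)"
    using up_ge_up_zero[of b a] assms by (intro mult_right_mono_neg) auto
  then show ?thesis using max[of 0] \<open>0 \<le> a\<close> by (simp add: stake_value_altdef)
qed

text \<open>Against an idle opponent no stake is optimal when a win is worth something: a positive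
  stake wins every stake turn however small it is, so zero can be raised and a positive stake
  halved.\<close>

lemma opponent_stake_pos:
  assumes "0 \<le> b" "0 \<le> a" and max: "\<And>s. 0 \<le> s \<Longrightarrow> stake_value x y b s \<le> stake_value x y b a"
    and "y < x"
  shows "0 < b"
proof (rule ccontr)
  assume "\<not> 0 < b"
  then have b: "b = 0" using assms by simp
  show False
  proof (cases "a = 0")
    case True
    \<comment> \<open>Staking instead of idling raises the chance from 1/2 to (1 + \<kappa>)/2, a
      gain of \<kappa>(x - y)/2, which is twice the stake tried next.\<close>
    have "0 < \<kappa> * (x - y)" using \<kappa> assms by simp
    then show False
      using max[of "\<kappa> * (x - y) / 4"] unfolding b True by (simp add: stake_value_altdef up_zero field_simps)
  next
    case False
    then have "0 < a" using assms by simp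
    then show False using max[of "a / 2"] unfolding b by (simp add: stake_value_altdef up_zero)
  qed
qed

lemma optimal_stake_critical:
  assumes a: "0 < a" and b: "0 < b" and max: "\<And>s. 0 \<le> s \<Longrightarrow> stake_value x y b s \<le> stake_value x y b a"
  shows "(a powr \<rho> + b powr \<rho>)\<^sup>2 = \<rho> * \<kappa> * a powr (\<rho> - 1) * b powr \<rho> * (x - y)"
proof -
  have "\<rho> * \<kappa> * a powr (\<rho> - 1) * b powr \<rho> * (x - y) / (a powr \<rho> + b powr \<rho>)\<^sup>2 - 1 = 0"
    by (rule DERIV_local_max[OF DERIV_stake_value[OF b a], of a]) (use a max in auto)
  moreover have "0 < (a powr \<rho> + b powr \<rho>)\<^sup>2"
    using a by (intro zero_less_power add_pos_nonneg) auto
  ultimately show ?thesis by (simp add: divide_eq_eq)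
qed

text \<open>After division by \<open>2 * (a powr \<rho> + b powr \<rho>)\<close> the two
  coefficients become the probabilities of stepping left and right. With \<open>s\<close> free, the
  lemma serves both mean equations.\<close>

lemma ABMN_mean_iff:
  assumes "0 < a" "0 < b"
  shows "2 * (a powr \<rho> + b powr \<rho>) * (z + s) =
       (a powr \<rho> * (1 - \<kappa>) + b powr \<rho> * (1 + \<kappa>)) * y +
       (a powr \<rho> * (1 + \<kappa>) + b powr \<rho> * (1 - \<kappa>)) * x \<longleftrightarrow>
    z + s = up b a * x + (1 - up b a) * y"
proof -
  have pos: "0 < b powr \<rho> + a powr \<rho>" using assms by (simp add: add_pos_nonneg)
  have up: "2 * (a powr \<rho> + b powr \<rho>) * up b a = a powr \<rho> * (1 + \<kappa>) + b powr \<rho> * (1 - \<kappa>)"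
    using assms pos by (simp add: up_prob_def stake_win_prob_def field_simps)
  have down: "2 * (a powr \<rho> + b powr \<rho>) * (1 - up b a) = a powr \<rho> * (1 - \<kappa>) + b powr \<rho> * (1 + \<kappa>)"
    unfolding right_diff_distrib up by (simp add: algebra_simps)
  have "(a powr \<rho> * (1 - \<kappa>) + b powr \<rho> * (1 + \<kappa>)) * y +
       (a powr \<rho> * (1 + \<kappa>) + b powr \<rho> * (1 - \<kappa>)) * x =
     2 * (a powr \<rho> + b powr \<rho>) * (up b a * x + (1 - up b a) * y)"
    unfolding up[symmetric] down[symmetric] by (simp only: ring_distribs ac_simps)
  then show ?thesis using pos by simp
qed

text \<open>At a site where neither player stakes, \<open>m\<close> is nonincreasing and \<open>n\<close> nondecreasing across
  the site, whereas at a site where both stake each player pays for a strict loss; neighbouring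
  sites are therefore of the same kind.\<close>

lemma stakes_all_or_none:
  fixes a b m n :: "int \<Rightarrow> real"
  assumes nonneg: "\<And>i. 0 \<le> a i" "\<And>i. 0 \<le> b i"
    and m: "\<And>i. m i = stake_value (m (i + 1)) (m (i - 1)) (b i) (a i)"
    and n: "\<And>i. n i = stake_value (n (i - 1)) (n (i + 1)) (a i) (b i)"
    and max_m: "\<And>i s. 0 \<le> s \<Longrightarrow> stake_value (m (i + 1)) (m (i - 1)) (b i) s \<le> m i"
    and max_n: "\<And>i s. 0 \<le> s \<Longrightarrow> stake_value (n (i - 1)) (n (i + 1)) (a i) s \<le> n i"
  shows "(\<forall>i. a i = 0 \<and> b i = 0) \<or>
    (\<forall>i. 0 < a i \<and> 0 < b i \<and> m i < m (i + 1) \<and> n (i + 1) < n i)"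
proof -
  have max_m': "stake_value (m (i + 1)) (m (i - 1)) (b i) s \<le> stake_value (m (i + 1)) (m (i - 1)) (b i) (a i)"
    if "0 \<le> s" for i s using max_m[OF that, of i] m[of i] by simp
  have max_n': "stake_value (n (i - 1)) (n (i + 1)) (a i) s \<le> stake_value (n (i - 1)) (n (i + 1)) (a i) (b i)"
    if "0 \<le> s" for i s using max_n[OF that, of i] n[of i] by simp
  have d: "m (i - 1) < m (i + 1) \<longleftrightarrow> 0 < a i" "0 < a i \<longleftrightarrow> 0 < b i" "n (i + 1) < n (i - 1) \<longleftrightarrow> 0 < b i" for i
  proof -
    \<comment> \<open>The four implications form a cycle: a gain open to Maxine, a stake by Mina, a
      gain open to Mina, a stake by Maxine.\<close>
    have 1: "m (i - 1) < m (i + 1) \<Longrightarrow> 0 < b i"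
      using opponent_stake_pos[OF nonneg(2,1) max_m'] by blast
    have 2: "0 < b i \<Longrightarrow> n (i + 1) < n (i - 1)"
      using optimal_stake_zero[OF nonneg max_n'] by (metis less_irrefl not_le)
    have 3: "n (i + 1) < n (i - 1) \<Longrightarrow> 0 < a i"
      using opponent_stake_pos[OF nonneg max_n'] by blast
    have 4: "0 < a i \<Longrightarrow> m (i - 1) < m (i + 1)"
      using optimal_stake_zero[OF nonneg(2,1) max_m'] by (metis less_irrefl not_le)
    show "m (i - 1) < m (i + 1) \<longleftrightarrow> 0 < a i" "0 < a i \<longleftrightarrow> 0 < b i" "n (i + 1) < n (i - 1) \<longleftrightarrow> 0 < b i"
      using 1 2 3 4 by blast+
  qed
  \<comment> \<open>A weighted mean is at most the better neighbour's value, and the positive stake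
    makes the inequality strict.\<close>
  have pos: "m i < m (i + 1) \<and> n i < n (i - 1)" if "0 < a i" for i
  proof -
    have "up (b i) (a i) * (m (i + 1) - m (i - 1)) \<le> m (i + 1) - m (i - 1)"
      "up (a i) (b i) * (n (i - 1) - n (i + 1)) \<le> n (i - 1) - n (i + 1)"
      using up_bounds d[of i] that by (auto intro!: mult_left_le_one_le)
    moreover have "0 < b i" using d(2) that by simp
    moreover note m[of i, unfolded stake_value_altdef] n[of i, unfolded stake_value_altdef]
    ultimately show ?thesis using that by linarith
  qed
  have zero: "m i \<le> m (i - 1) \<and> m (i + 1) \<le> m i \<and> n (i - 1) \<le> n i \<and> n i \<le> n (i + 1)" if "\<not> 0 < a i" for i
  proof -
    have "a i = 0" "b i = 0" using that d(2)[of i] nonneg by (auto simp: less_le)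
    then have "m i = (m (i + 1) + m (i - 1)) / 2" "n i = (n (i + 1) + n (i - 1)) / 2"
      using m[of i] n[of i] by (simp_all add: stake_value_def up_zero)
    moreover have "m (i + 1) \<le> m (i - 1)" "n (i - 1) \<le> n (i + 1)"
      using that d[of i] by (simp_all add: not_less)
    ultimately show ?thesis by simp
  qed
  \<comment> \<open>If only the left of two neighbouring sites has stakes, then \<open>m\<close>
    must rise between them by \<open>pos\<close> and not rise by \<open>zero\<close>. If only the
    right one has, \<open>n\<close> must fall between them by \<open>pos\<close> and not fall by
    \<open>zero\<close>.\<close>
  have "0 < a (i + 1) \<longleftrightarrow> 0 < a i" for i
    using pos[of i] pos[of "i + 1"] zero[of i] zero[of "i + 1"] by fastforce
  then have step: "0 < a i \<longleftrightarrow> 0 < a (i + 1)" for i by simp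
  have all: "0 < a i \<longleftrightarrow> 0 < a 0" for i
  proof (induction i rule: int_induct[where k=0])
    case (step1 i)
    then show ?case using step[of i] by simp
  next
    case (step2 i)
    then show ?case using step[of "i - 1"] by simp
  qed simp
  show ?thesis
  proof (cases "0 < a 0")
    case True
    then have "\<And>i. 0 < a i" using all by simp
    then show ?thesis using pos d(2) by (metis add_diff_cancel_right')
  next
    case False
    then have "\<And>i. \<not> 0 < a i" using all by simp
    then show ?thesis using d(2) nonneg by (metis less_le)
  qed
qed

end

section \<open>Winning against an opponent who does not stake\<close>

context trail_of_lost_pennies
begin

text \<open>The exponential \<open>f\<close> shrinks in mean by the factor
  \<open>1 - \<kappa>\<^sup>2 / 2\<close> at each turn, so the sum of the \<open>f (X k)\<close> has
  finite mean. Hence \<open>f (X k)\<close> tends to 0, which means escape in direction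
  \<open>\<sigma>\<close>.\<close>

lemma AE_biased_escape:
  fixes \<sigma> :: int
  assumes \<sigma>: "\<sigma> = 1 \<or> \<sigma> = -1"
    and bias: "\<And>\<psi>. \<psi> \<in> paths_from l \<Longrightarrow> up (S\<^sub>m \<psi>) (S\<^sub>p \<psi>) = (1 + of_int \<sigma> * \<kappa>) / 2"
  shows "AE X in law S\<^sub>m S\<^sub>p l. filterlim (\<lambda>k. \<sigma> * X k) at_top sequentially"
proof -
  \<comment> \<open>With this base, (1 + \<kappa>)\<theta>/2 + (1 - \<kappa>)/(2\<theta>) = 1 -
    \<kappa>^2/2, which is below 1.\<close>
  define \<theta> where "\<theta> = 1 / (1 + \<kappa>)"
  define f :: "int \<Rightarrow> real" where "f i = \<theta> powr of_int (\<sigma> * i)" for i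
  \<comment> \<open>The drift of \<open>f\<close> is given the type of a strategy so that the
    results on mean and running costs apply to it.\<close>
  define D :: strategy where "D \<psi> = \<kappa>\<^sup>2 / 2 * f (last \<psi>)" for \<psi>
  have \<theta>: "0 < \<theta>" "\<theta> < 1" using \<kappa> by (auto simp: \<theta>_def)
  have fpos: "0 < f i" for i using \<theta> by (simp add: f_def)
  have f: "(1 + of_int \<sigma> * \<kappa>) / 2 * f (i + 1) + (1 - (1 + of_int \<sigma> * \<kappa>) / 2) * f (i - 1) + \<kappa>\<^sup>2 / 2 * f i = f i" for i
  proof -
    have "\<sigma> * (i + \<sigma>) = \<sigma> * i + 1" "\<sigma> * (i - \<sigma>) = \<sigma> * i - 1" using \<sigma> by auto
    then have 1: "f (i + \<sigma>) = f i * \<theta>" "f (i - \<sigma>) = f i / \<theta>"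
      using \<theta> by (simp_all add: f_def powr_add powr_diff del: of_int_mult)
    have 2: "(1 + \<kappa>) / 2 * \<theta> + (1 - \<kappa>) / 2 / \<theta> + \<kappa>\<^sup>2 / 2 = 1"
      using \<kappa> by (simp add: \<theta>_def field_simps power2_eq_square)
    have "(1 + of_int \<sigma> * \<kappa>) / 2 * f (i + 1) + (1 - (1 + of_int \<sigma> * \<kappa>) / 2) * f (i - 1) + \<kappa>\<^sup>2 / 2 * f i =
        (1 + \<kappa>) / 2 * f (i + \<sigma>) + (1 - \<kappa>) / 2 * f (i - \<sigma>) + \<kappa>\<^sup>2 / 2 * f i"
      using \<sigma> by (auto simp: field_simps)
    also have "\<dots> = ((1 + \<kappa>) / 2 * \<theta> + (1 - \<kappa>) / 2 / \<theta> + \<kappa>\<^sup>2 / 2) * f i"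
      unfolding 1 by (simp add: field_simps)
    finally show ?thesis unfolding 2 by simp
  qed
  have "(\<integral>\<^sup>+X. (\<Sum>j<k. ennreal (D (history X j))) \<partial>law S\<^sub>m S\<^sub>p l) \<le> ennreal (f l)" for k
  proof -
    have "(\<integral>\<^sup>+X. ennreal (f (X k) - 0) \<partial>law S\<^sub>m S\<^sub>p l) +
      (\<integral>\<^sup>+X. (\<Sum>j<k. ennreal (D (history X j))) \<partial>law S\<^sub>m S\<^sub>p l) =
    ennreal (f l - 0) + (\<integral>\<^sup>+X. (\<Sum>j<k. ennreal (0::real)) \<partial>law S\<^sub>m S\<^sub>p l)"
    proof (rule expectation_telescope[where S="\<lambda>_. 0"])
      fix \<psi> assume \<psi>: "\<psi> \<in> paths_from l"
      show "f (last \<psi>) + 0 = up (S\<^sub>m \<psi>) (S\<^sub>p \<psi>) * f (last \<psi> + 1) +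
          (1 - up (S\<^sub>m \<psi>) (S\<^sub>p \<psi>)) * f (last \<psi> - 1) + D \<psi>"
        unfolding bias[OF \<psi>] D_def using f[of "last \<psi>"] by simp
    qed (use fpos in \<open>simp_all add: less_imp_le D_def\<close>)
    then have "(\<integral>\<^sup>+X. ennreal (f (X k)) \<partial>law S\<^sub>m S\<^sub>p l) +
      (\<integral>\<^sup>+X. (\<Sum>j<k. ennreal (D (history X j))) \<partial>law S\<^sub>m S\<^sub>p l) = ennreal (f l)"
      by simp
    then show ?thesis by (metis le_iff_add add.commute)
  qed
  then have "mean_cost D S\<^sub>m S\<^sub>p l \<le> ennreal (f l)"
    by (intro tendsto_upperbound[OF partial_cost_tendsto]) auto
  then have "mean_cost D S\<^sub>m S\<^sub>p l \<noteq> \<infinity>" by (auto simp: top_unique)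
  then have "AE X in law S\<^sub>m S\<^sub>p l. running_cost D X \<noteq> \<infinity>"
    unfolding mean_cost_def by (intro nn_integral_PInf_AE) simp_all
  then show ?thesis
  proof eventually_elim
    case (elim X)
    have "summable (\<lambda>k. \<kappa>\<^sup>2 / 2 * f (X k))"
      using elim fpos
      by (intro summable_suminf_not_top) (auto simp: less_imp_le running_cost_def D_def)
    then have "summable (\<lambda>k. f (X k))"
      using \<kappa> by (subst (asm) summable_cmult_iff) auto
    then have lim: "(\<lambda>k. f (X k)) \<longlonglongrightarrow> 0" by (rule summable_LIMSEQ_zero)
    have "\<forall>\<^sub>F k in sequentially. Z \<le> \<sigma> * X k" for Z
    proof -
      have "0 < \<theta> powr of_int Z" using \<theta> by simp
      from order_tendstoD(2)[OF lim this] show ?thesis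
      proof eventually_elim
        case (elim k)
        show ?case
        proof (rule ccontr)
          assume "\<not> Z \<le> \<sigma> * X k"
          then have "\<theta> powr of_int Z \<le> \<theta> powr of_int (\<sigma> * X k)"
            using \<theta> by (intro powr_mono') (simp_all del: of_int_mult)
          then show False using elim by (simp add: f_def)
        qed
      qed
    qed
    then show ?case by (simp add: filterlim_at_top)
  qed
qed

text \<open>The total cost is at most \<open>\<epsilon>\<close>, yet every stake turn against an idle opponent is won.\<close>

definition vanishing_stakes :: "real \<Rightarrow> strategy" where
  "vanishing_stakes \<epsilon> = (\<lambda>\<psi>\<in>paths. \<epsilon> * (1 / 2) ^ length \<psi>)"

lemma vanishing_stakes_strategy: "0 \<le> \<epsilon> \<Longrightarrow> vanishing_stakes \<epsilon> \<in> strategies"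
  by (auto simp: vanishing_stakes_def strategies_def)

lemma mean_cost_vanishing_stakes:
  assumes "0 \<le> \<epsilon>"
  shows "mean_cost (vanishing_stakes \<epsilon>) S\<^sub>m S\<^sub>p l = ennreal \<epsilon>"
proof -
  have "AE X in law S\<^sub>m S\<^sub>p l. running_cost (vanishing_stakes \<epsilon>) X = ennreal \<epsilon>"
    using AE_history_paths_from
  proof eventually_elim
    case (elim X)
    \<comment> \<open>The history at time \<open>k\<close> has length \<open>Suc k\<close>, so the
      series of halves starts at 1/2 and sums to 1.\<close>
    then have "running_cost (vanishing_stakes \<epsilon>) X = (\<Sum>k. ennreal (\<epsilon> * (1 / 2) ^ Suc k))"
      by (simp add: running_cost_def vanishing_stakes_def paths_from_def)
    also have "\<dots> = ennreal (\<epsilon> * 1)"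
      by (rule suminf_ennreal_eq) (use assms in simp, rule sums_mult, rule power_half_series)
    finally show ?case by simp
  qed
  then have "mean_cost (vanishing_stakes \<epsilon>) S\<^sub>m S\<^sub>p l = (\<integral>\<^sup>+X. ennreal \<epsilon> \<partial>law S\<^sub>m S\<^sub>p l)"
    unfolding mean_cost_def by (rule nn_integral_cong_AE)
  then show ?thesis by simp
qed

lemma vanishing_stakes_pos: "\<psi> \<in> paths_from l \<Longrightarrow> 0 < \<epsilon> \<Longrightarrow> 0 < vanishing_stakes \<epsilon> \<psi>"
  by (simp add: vanishing_stakes_def paths_from_def)

lemma mean_terminal_eq_AE:
  assumes "AE X in law S\<^sub>m S\<^sub>p l. terminal_receipt u v w X = z"
  shows "mean_terminal u v w S\<^sub>m S\<^sub>p l = z"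
proof -
  interpret prob_space "law S\<^sub>m S\<^sub>p l" by (rule prob_space_play_law)
  have "mean_terminal u v w S\<^sub>m S\<^sub>p l = (\<integral>X. z \<partial>law S\<^sub>m S\<^sub>p l)"
    unfolding mean_terminal_def by (rule integral_cong_AE) (use assms in auto)
  then show ?thesis using prob_space by simp
qed

text \<open>An idle Mina loses all stake turns, so the walk is biased to the right and escapes there
  almost surely, at total cost \<open>\<epsilon>\<close>.\<close>

lemma payoff_vanishing_stakes_Maxine:
  assumes "0 < \<epsilon>" and zero: "\<And>\<psi>. \<psi> \<in> paths_from l \<Longrightarrow> S\<^sub>m \<psi> = 0"
  shows "payoff u v w (vanishing_stakes \<epsilon>) S\<^sub>m (vanishing_stakes \<epsilon>) l = ereal (v - \<epsilon>)"
proof -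
  have "AE X in law S\<^sub>m (vanishing_stakes \<epsilon>) l. filterlim (\<lambda>k. 1 * X k) at_top sequentially"
    by (rule AE_biased_escape) (use assms vanishing_stakes_pos in \<open>auto simp: up_zero\<close>)
  then have "mean_terminal u v w S\<^sub>m (vanishing_stakes \<epsilon>) l = v"
    by (intro mean_terminal_eq_AE) (elim eventually_mono, simp add: terminal_receipt_def)
  then show ?thesis
    using assms unfolding payoff_eq by (simp add: mean_cost_vanishing_stakes)
qed

lemma payoff_vanishing_stakes_Mina:
  assumes "0 < \<epsilon>" and zero: "\<And>\<psi>. \<psi> \<in> paths_from l \<Longrightarrow> S\<^sub>p \<psi> = 0"
  shows "payoff u v w (vanishing_stakes \<epsilon>) (vanishing_stakes \<epsilon>) S\<^sub>p l = ereal (u - \<epsilon>)"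
proof -
  have "AE X in law (vanishing_stakes \<epsilon>) S\<^sub>p l. filterlim (\<lambda>k. (- 1) * X k) at_top sequentially"
  proof (rule AE_biased_escape)
    fix \<psi> assume "\<psi> \<in> paths_from l"
    then show "up (vanishing_stakes \<epsilon> \<psi>) (S\<^sub>p \<psi>) = (1 + of_int (- 1) * \<kappa>) / 2"
      using assms vanishing_stakes_pos by (subst up_swap) (auto simp: up_zero field_simps)
  qed simp
  then have "AE X in law (vanishing_stakes \<epsilon>) S\<^sub>p l. terminal_receipt u v w X = u"
  proof eventually_elim
    case (elim X)
    have "filterlim X at_bot sequentially"
    proof (subst filterlim_at_bot, intro allI)
      fix Z
      from elim have "\<forall>\<^sub>F k in sequentially. - Z \<le> (- 1) * X k" unfolding filterlim_at_top by blast
      then show "\<forall>\<^sub>F k in sequentially. X k \<le> Z" by eventually_elim simp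
    qed
    then show ?case using not_filterlim_at_top_at_bot[of X] by (simp add: terminal_receipt_def)
  qed
  then have "mean_terminal u v w (vanishing_stakes \<epsilon>) S\<^sub>p l = u" by (rule mean_terminal_eq_AE)
  then show ?thesis
    using assms unfolding payoff_eq by (simp add: mean_cost_vanishing_stakes)
qed

section \<open>Stationary play\<close>

lemma strategies_nonneg: "S \<in> strategies \<Longrightarrow> \<psi> \<in> paths_from l \<Longrightarrow> 0 \<le> S \<psi>"
  by (auto simp: strategies_def paths_from_def)

lemma paths_fromD: "\<psi> \<in> paths_from l \<Longrightarrow> \<psi> \<in> paths"
  by (simp add: paths_from_def)

lemma time_invariantD:
  assumes "S \<in> time_invariant_strategies"
  shows "S \<in> strategies" "\<psi> \<in> paths \<Longrightarrow> S \<psi> = S [last \<psi>]"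
proof -
  show "S \<in> strategies" using assms by (simp add: time_invariant_strategies_def)
  assume "\<psi> \<in> paths"
  moreover have "[last \<psi>] \<in> paths" by (simp add: paths_def)
  moreover have "\<forall>\<phi>\<in>paths. \<forall>\<psi>\<in>paths. last \<phi> = last \<psi> \<longrightarrow> S \<phi> = S \<psi>"
    using assms unfolding time_invariant_strategies_def by blast
  ultimately show "S \<psi> = S [last \<psi>]" by (metis last.simps)
qed

lemma time_invariant_Cons:
  assumes "S \<in> time_invariant_strategies" "\<bar>y - l\<bar> = 1" "\<psi> \<in> paths_from y"
  shows "S (l # \<psi>) = S \<psi>"
  using time_invariantD(2)[OF assms(1) paths_fromD[OF Cons_paths_from[OF assms(3,2)]]]
    time_invariantD(2)[OF assms(1) paths_fromD[OF assms(3)]] last_Cons_paths_from[OF assms(3), of l]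
  by simp

lemma stationary_time_invariant:
  assumes "\<And>i. 0 \<le> s i"
  shows "stationary_strategy s \<in> time_invariant_strategies"
  using assms unfolding stationary_strategy_def time_invariant_strategies_def strategies_def by simp

text \<open>Idling secures the worst receipt; compared with this deviation, an equilibrium payoff
  cannot be \<open>- \<infinity>\<close>.\<close>

lemma payoff_zero_stakes_ge:
  assumes "w \<le> u" "w \<le> v"
  shows "ereal w \<le> payoff u v w (\<lambda>\<psi>\<in>paths. 0) S\<^sub>m S\<^sub>p l"
proof -
  have "mean_cost (\<lambda>\<psi>\<in>paths. 0) S\<^sub>m S\<^sub>p l = mean_cost (vanishing_stakes 0) S\<^sub>m S\<^sub>p l"
    by (simp add: vanishing_stakes_def)
  then have "mean_cost (\<lambda>\<psi>\<in>paths. 0) S\<^sub>m S\<^sub>p l = 0"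
    by (simp add: mean_cost_vanishing_stakes)
  moreover have "w \<le> mean_terminal u v w S\<^sub>m S\<^sub>p l"
    by (rule mean_terminal_bounds(1)[where H="max u v"]) (use assms in auto)
  ultimately show ?thesis by (simp add: payoff_eq zero_ennreal.rep_eq)
qed

lemma payoff_le_max:
  assumes "payoff u v w S S\<^sub>m S\<^sub>p l = ereal x" "u \<le> H" "v \<le> H" "w \<le> H"
  shows "x \<le> H"
  using assms mean_terminal_bounds(2)[of "min u (min v w)" u v w H S\<^sub>m S\<^sub>p l] enn2real_nonneg[of "mean_cost S S\<^sub>m S\<^sub>p l"]
  unfolding payoff_finite_iff by linarith

lemma payoff_MInf_or_real: "payoff u v w S S\<^sub>m S\<^sub>p l = - \<infinity> \<or> (\<exists>x. payoff u v w S S\<^sub>m S\<^sub>p l = ereal x)"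
  unfolding payoff_eq by (cases "mean_cost S S\<^sub>m S\<^sub>p l") auto

text \<open>Here \<open>mean_terminal 0 1 0\<close> is the probability of escape to the right, and
  under almost sure escape every terminal receipt is an affine function of that event's
  indicator.\<close>

lemma mean_terminal_escape:
  assumes "AE X in law S\<^sub>m S\<^sub>p l. filterlim X at_top sequentially \<or> filterlim X at_bot sequentially"
  shows "mean_terminal u v w S\<^sub>m S\<^sub>p l = u + (v - u) * mean_terminal 0 1 0 S\<^sub>m S\<^sub>p l"
proof -
  interpret prob_space "law S\<^sub>m S\<^sub>p l" by (rule prob_space_play_law)
  have "mean_terminal u v w S\<^sub>m S\<^sub>p l = (\<integral>X. u + (v - u) * terminal_receipt 0 1 0 X \<partial>law S\<^sub>m S\<^sub>p l)"
    unfolding mean_terminal_def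
  proof (rule integral_cong_AE)
    show "AE X in law S\<^sub>m S\<^sub>p l. terminal_receipt u v w X = u + (v - u) * terminal_receipt 0 1 0 X"
      using assms by eventually_elim (auto simp: terminal_receipt_def)
  qed simp_all
  then show ?thesis
    unfolding mean_terminal_def using prob_space integrable_terminal_receipt by simp
qed

text \<open>Changing a strategy at the single path \<open>[i]\<close> alters the first turn only,
  since all later histories are longer lists; even on a return to \<open>i\<close> the old stake is
  used. The unchanged pair then supplies the continuation values.\<close>

lemma one_shot_deviation:
  assumes inv: "S\<^sub>m \<in> time_invariant_strategies" "S\<^sub>p \<in> time_invariant_strategies"
    and s: "0 \<le> s"
  shows "payoff u v w S\<^sub>p S\<^sub>m S\<^sub>p (i + 1) = ereal x \<Longrightarrow> payoff u v w S\<^sub>p S\<^sub>m S\<^sub>p (i - 1) = ereal y \<Longrightarrow>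
      payoff u v w (S\<^sub>p([i] := s)) S\<^sub>m (S\<^sub>p([i] := s)) i = ereal (stake_value x y (S\<^sub>m [i]) s)"
    and "payoff u v w S\<^sub>m S\<^sub>m S\<^sub>p (i + 1) = ereal x \<Longrightarrow> payoff u v w S\<^sub>m S\<^sub>m S\<^sub>p (i - 1) = ereal y \<Longrightarrow>
      payoff u v w (S\<^sub>m([i] := s)) (S\<^sub>m([i] := s)) S\<^sub>p i = ereal (stake_value y x (S\<^sub>p [i]) s)"
proof -
  have agree: "(S([i] := s)) (i # \<psi>) = S \<psi>"
    if "S \<in> time_invariant_strategies" "\<bar>y - i\<bar> = 1" "\<psi> \<in> paths_from y" for S :: strategy and y \<psi>
    using time_invariant_Cons[OF that] that(3) by (auto simp: paths_from_def paths_def)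
  note inv_Cons = inv[THEN time_invariant_Cons] inv[THEN agree]
  show "payoff u v w (S\<^sub>p([i] := s)) S\<^sub>m (S\<^sub>p([i] := s)) i = ereal (stake_value x y (S\<^sub>m [i]) s)"
    if "payoff u v w S\<^sub>p S\<^sub>m S\<^sub>p (i + 1) = ereal x" "payoff u v w S\<^sub>p S\<^sub>m S\<^sub>p (i - 1) = ereal y"
    using payoff_step[where S="S\<^sub>p([i] := s)" and S\<^sub>m=S\<^sub>m and S\<^sub>p="S\<^sub>p([i] := s)" and l=i,
      OF inv_Cons(1,4,4) _ that] s
    by (simp add: stake_value_def)
  show "payoff u v w (S\<^sub>m([i] := s)) (S\<^sub>m([i] := s)) S\<^sub>p i = ereal (stake_value y x (S\<^sub>p [i]) s)"
    if "payoff u v w S\<^sub>m S\<^sub>m S\<^sub>p (i + 1) = ereal x" "payoff u v w S\<^sub>m S\<^sub>m S\<^sub>p (i - 1) = ereal y"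
    using payoff_step[where S="S\<^sub>m([i] := s)" and S\<^sub>m="S\<^sub>m([i] := s)" and S\<^sub>p=S\<^sub>p and l=i,
      OF inv_Cons(3,2,3) _ that] s up_swap[of s "S\<^sub>p [i]"]
    by (simp add: stake_value_def)
qed

section \<open>Equilibria in terms of payoffs\<close>

lemma mean_receipt_eq_payoff:
  "mean_receipt_Maxine \<kappa> \<rho> u v w S\<^sub>m S\<^sub>p l = payoff u v w S\<^sub>p S\<^sub>m S\<^sub>p l"
  "mean_receipt_Mina \<kappa> \<rho> u v w S\<^sub>m S\<^sub>p l = payoff u v w S\<^sub>m S\<^sub>m S\<^sub>p l"
  by (simp_all add: mean_receipt_Maxine_def mean_receipt_Mina_def payoff_def)

lemma nash_equilibria_iff:
  "(S\<^sub>m, S\<^sub>p) \<in> nash_equilibria \<kappa> \<rho> m_star n_star m_ninf m_pinf n_ninf n_pinf \<longleftrightarrow>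
    S\<^sub>m \<in> strategies \<and> S\<^sub>p \<in> strategies \<and> (\<forall>S\<in>strategies. \<forall>l.
      payoff m_ninf m_pinf m_star S S\<^sub>m S l \<le> payoff m_ninf m_pinf m_star S\<^sub>p S\<^sub>m S\<^sub>p l \<and>
      payoff n_ninf n_pinf n_star S S S\<^sub>p l \<le> payoff n_ninf n_pinf n_star S\<^sub>m S\<^sub>m S\<^sub>p l)"
  by (auto simp: nash_equilibria_def mean_receipt_eq_payoff)

end

section \<open>The two implications\<close>

text \<open>An affine function of one variable is determined by its values at two distinct
  points.\<close>

lemma affine_relation_coeffs:
  fixes u v u' v' :: real
  assumes "u' + (v' - u') * h = u + (v - u) * h" "u' + (v' - u') * k = u + (v - u) * k" "h \<noteq> k"
  shows "u' = u" "v' = v"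
proof -
  have "((v' - u') - (v - u)) * (h - k) = 0" using assms(1,2) by (simp add: algebra_simps)
  then have "v' - u' = v - u" using assms(3) by simp
  then show "u' = u" "v' = v" using assms(1) by simp_all
qed

context trail_of_lost_pennies
begin

text \<open>Puts both players' equations into the same shape, with stakes and neighbours exchanged
  for Mina, so that each result on \<open>stake_value\<close> applies twice.\<close>

lemma ABMN_stake_values:
  "(a, b, m, n) \<in> ABMN \<kappa> \<rho> \<longleftrightarrow> (\<forall>i. 0 < a i \<and> 0 < b i \<and>
    m i = stake_value (m (i + 1)) (m (i - 1)) (b i) (a i) \<and>
    n i = stake_value (n (i - 1)) (n (i + 1)) (a i) (b i) \<and>
    (a i powr \<rho> + b i powr \<rho>)\<^sup>2 = \<rho> * \<kappa> * a i powr (\<rho> - 1) * b i powr \<rho> * (m (i + 1) - m (i - 1)) \<and>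
    (b i powr \<rho> + a i powr \<rho>)\<^sup>2 = \<rho> * \<kappa> * b i powr (\<rho> - 1) * a i powr \<rho> * (n (i - 1) - n (i + 1)))"
  (is "_ \<longleftrightarrow> (\<forall>i. ?R i)")
proof -
  have "(0 < a i \<and> 0 < b i \<and>
     2 * (a i powr \<rho> + b i powr \<rho>) * (m i + a i) =
       (a i powr \<rho> * (1 - \<kappa>) + b i powr \<rho> * (1 + \<kappa>)) * m (i - 1) +
       (a i powr \<rho> * (1 + \<kappa>) + b i powr \<rho> * (1 - \<kappa>)) * m (i + 1) \<and>
     2 * (a i powr \<rho> + b i powr \<rho>) * (n i + b i) =
       (a i powr \<rho> * (1 - \<kappa>) + b i powr \<rho> * (1 + \<kappa>)) * n (i - 1) +
       (a i powr \<rho> * (1 + \<kappa>) + b i powr \<rho> * (1 - \<kappa>)) * n (i + 1) \<and>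
     (a i powr \<rho> + b i powr \<rho>)\<^sup>2 =
       \<rho> * \<kappa> * a i powr (\<rho> - 1) * b i powr \<rho> * (m (i + 1) - m (i - 1)) \<and>
     (a i powr \<rho> + b i powr \<rho>)\<^sup>2 =
       \<rho> * \<kappa> * a i powr \<rho> * b i powr (\<rho> - 1) * (n (i - 1) - n (i + 1))) \<longleftrightarrow> ?R i" for i
  proof (cases "0 < a i \<and> 0 < b i")
    case True
    have "m i + a i = up (b i) (a i) * m (i + 1) + (1 - up (b i) (a i)) * m (i - 1) \<longleftrightarrow>
        m i = stake_value (m (i + 1)) (m (i - 1)) (b i) (a i)"
      by (auto simp: stake_value_def)
    moreover have "n i + b i = up (b i) (a i) * n (i + 1) + (1 - up (b i) (a i)) * n (i - 1) \<longleftrightarrow>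
        n i = stake_value (n (i - 1)) (n (i + 1)) (a i) (b i)"
      unfolding stake_value_def up_swap[of "a i" "b i"] by auto
    ultimately show ?thesis
      using True by (simp only: ABMN_mean_iff) (simp only: ac_simps)
  qed auto
  then show ?thesis unfolding ABMN_def by blast
qed

lemma stake_value_Mina: "stake_value x y a b = up b a * y + (1 - up b a) * x - b"
  by (simp add: stake_value_def up_swap[of a b])

text \<open>Under the given pair \<open>m\<close> and \<open>n\<close> are martingale values, hence
  equal the payoffs. When one player deviates, that player's function becomes a supermartingale
  value, since the given stakes maximise \<open>stake_value\<close> at every site.\<close>

lemma ABMN_imp_nash:
  assumes q: "(a, b, m, n) \<in> ABMN \<kappa> \<rho>"
    and bd: "has_boundary_data (a, b, m, n) m_ninf m_pinf n_ninf n_pinf"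
    and star: "m_star \<le> m_ninf" "n_star \<le> n_pinf"
  shows "stationary_strategy b \<in> time_invariant_strategies" "stationary_strategy a \<in> time_invariant_strategies"
    "(stationary_strategy b, stationary_strategy a)
       \<in> nash_equilibria \<kappa> \<rho> m_star n_star m_ninf m_pinf n_ninf n_pinf"
proof -
  note Q = q[unfolded ABMN_stake_values, rule_format]
  have pos: "0 < a i" "0 < b i" for i using Q by blast+
  have m: "m i = stake_value (m (i + 1)) (m (i - 1)) (b i) (a i)"
    and n: "n i = stake_value (n (i - 1)) (n (i + 1)) (a i) (b i)" for i using Q by blast+
  have cm: "(a i powr \<rho> + b i powr \<rho>)\<^sup>2 = \<rho> * \<kappa> * a i powr (\<rho> - 1) * b i powr \<rho> * (m (i + 1) - m (i - 1))"
    and cn: "(b i powr \<rho> + a i powr \<rho>)\<^sup>2 = \<rho> * \<kappa> * b i powr (\<rho> - 1) * a i powr \<rho> * (n (i - 1) - n (i + 1))"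
    for i using Q by blast+
  note max_m = stake_value_le[OF pos(2,1) _ cm] and max_n = stake_value_le[OF pos _ cn]
  let ?b = "stationary_strategy b" and ?a = "stationary_strategy a"
  show inv: "?b \<in> time_invariant_strategies" "?a \<in> time_invariant_strategies"
    using pos by (auto intro!: stationary_time_invariant less_imp_le)
  have stat: "stationary_strategy s \<psi> = s (last \<psi>)" if "\<psi> \<in> paths_from l" for s \<psi> l
    using that by (simp add: stationary_strategy_def paths_from_def)
  have lim_m: "(m \<longlongrightarrow> m_pinf) at_top" "(m \<longlongrightarrow> m_ninf) at_bot"
    and lim_n: "(n \<longlongrightarrow> n_pinf) at_top" "(n \<longlongrightarrow> n_ninf) at_bot"
    using bd by (auto simp: has_boundary_data_def intro: tendsto_int_at_top tendsto_int_at_bot)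
  have "m (i - 1) \<le> m (i + 1)" for i using max_m(1)[of 0 i] by simp
  note m_bounds = two_step_mono_bounds[OF this lim_m]
  \<comment> \<open>\<open>n\<close> falls from left to right within a parity class, so its bounds
    come from the monotone case applied to its negative.\<close>
  have "- n (i - 1) \<le> - n (i + 1)" for i using max_n(1)[of 0 i] by simp
  from two_step_mono_bounds[OF this tendsto_minus[OF lim_n(1)] tendsto_minus[OF lim_n(2)]]
  have n_bounds: "n_pinf \<le> n i" "n i \<le> n_ninf" for i by simp_all
  have val: "payoff m_ninf m_pinf m_star ?a ?b ?a l = ereal (m l)"
    "payoff n_ninf n_pinf n_star ?b ?b ?a l = ereal (n l)" for l
  proof -
    show "payoff m_ninf m_pinf m_star ?a ?b ?a l = ereal (m l)"
    proof (rule martingale_limit(2)[where a=a])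
      fix \<psi> assume \<psi>: "\<psi> \<in> paths_from l"
      show "m (last \<psi>) + ?a \<psi> = up (?b \<psi>) (?a \<psi>) * m (last \<psi> + 1) + (1 - up (?b \<psi>) (?a \<psi>)) * m (last \<psi> - 1)"
        using m[of "last \<psi>"] by (simp add: stat[OF \<psi>] stake_value_def)
    qed (use pos m_bounds lim_m stat in auto)
    show "payoff n_ninf n_pinf n_star ?b ?b ?a l = ereal (n l)"
    proof (rule martingale_limit(2)[where a=b])
      fix \<psi> assume \<psi>: "\<psi> \<in> paths_from l"
      show "n (last \<psi>) + ?b \<psi> = up (?b \<psi>) (?a \<psi>) * n (last \<psi> + 1) + (1 - up (?b \<psi>) (?a \<psi>)) * n (last \<psi> - 1)"
        using n[of "last \<psi>"] by (simp add: stat[OF \<psi>] stake_value_Mina)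
    qed (use pos n_bounds lim_n stat in auto)
  qed
  have "payoff m_ninf m_pinf m_star S ?b S l \<le> ereal (m l)" if S: "S \<in> strategies" for S l
  proof (rule payoff_le_supermartingale)
    fix \<psi> assume \<psi>: "\<psi> \<in> paths_from l"
    show "0 \<le> S \<psi>" using strategies_nonneg[OF S \<psi>] .
    from max_m(2)[OF this, of "last \<psi>"] m[of "last \<psi>"]
    show "up (?b \<psi>) (S \<psi>) * m (last \<psi> + 1) + (1 - up (?b \<psi>) (S \<psi>)) * m (last \<psi> - 1) \<le> m (last \<psi>) + S \<psi>"
      by (simp add: stat[OF \<psi>] stake_value_def)
  next
    show "m_star \<le> m i" for i using star(1) m_bounds(1)[of i] by simp
  qed (use lim_m in auto)
  moreover have "payoff n_ninf n_pinf n_star S S ?a l \<le> ereal (n l)" if S: "S \<in> strategies" for S l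
  proof (rule payoff_le_supermartingale)
    fix \<psi> assume \<psi>: "\<psi> \<in> paths_from l"
    show "0 \<le> S \<psi>" using strategies_nonneg[OF S \<psi>] .
    from max_n(2)[OF this, of "last \<psi>"] n[of "last \<psi>"]
    show "up (S \<psi>) (?a \<psi>) * n (last \<psi> + 1) + (1 - up (S \<psi>) (?a \<psi>)) * n (last \<psi> - 1) \<le> n (last \<psi>) + S \<psi>"
      by (simp add: stat[OF \<psi>] stake_value_Mina)
  next
    show "n_star \<le> n i" for i using star(2) n_bounds(1)[of i] by simp
  qed (use lim_n in auto)
  ultimately show "(?b, ?a) \<in> nash_equilibria \<kappa> \<rho> m_star n_star m_ninf m_pinf n_ninf n_pinf"
    unfolding nash_equilibria_iff using inv time_invariantD(1) by (simp add: val)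
qed

lemma nash_imp_ABMN:
  assumes inv: "S\<^sub>m \<in> time_invariant_strategies" "S\<^sub>p \<in> time_invariant_strategies"
    and nash: "(S\<^sub>m, S\<^sub>p) \<in> nash_equilibria \<kappa> \<rho> m_star n_star m_ninf m_pinf n_ninf n_pinf"
    and data: "m_ninf < m_pinf" "n_pinf < n_ninf" "m_star < m_ninf" "n_star < n_pinf"
  obtains q where "associated_quadruple \<kappa> \<rho> m_star n_star m_ninf m_pinf n_ninf n_pinf (S\<^sub>m, S\<^sub>p) q"
    "q \<in> ABMN \<kappa> \<rho>" "has_boundary_data q m_ninf m_pinf n_ninf n_pinf"
proof -
  let ?M = "payoff m_ninf m_pinf m_star" and ?N = "payoff n_ninf n_pinf n_star"
  have best: "?M S S\<^sub>m S l \<le> ?M S\<^sub>p S\<^sub>m S\<^sub>p l" "?N S S S\<^sub>p l \<le> ?N S\<^sub>m S\<^sub>m S\<^sub>p l" if "S \<in> strategies" for S l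
    using nash that unfolding nash_equilibria_iff by blast+
  define a where "a i = S\<^sub>p [i]" for i
  define b where "b i = S\<^sub>m [i]" for i
  have S: "S\<^sub>p \<psi> = a (last \<psi>)" "S\<^sub>m \<psi> = b (last \<psi>)" if "\<psi> \<in> paths_from l" for \<psi> l
    unfolding a_def b_def using time_invariantD(2) inv paths_fromD[OF that] by blast+
  have nonneg: "0 \<le> a i" "0 \<le> b i" for i
    using strategies_nonneg[OF time_invariantD(1)[OF inv(2)] singleton_paths_from[of i]]
      strategies_nonneg[OF time_invariantD(1)[OF inv(1)] singleton_paths_from[of i]]
    by (simp_all add: a_def b_def)
  have idle: "(\<lambda>\<psi>\<in>paths. 0) \<in> strategies" by (simp add: strategies_def)
  \<comment> \<open>Equilibrium payoffs are at least what idling yields, hence real, and can serve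
    as continuation values.\<close>
  have "\<exists>x. ?M S\<^sub>p S\<^sub>m S\<^sub>p l = ereal x \<and> m_star \<le> x" for l
  proof -
    have "ereal m_star \<le> ?M S\<^sub>p S\<^sub>m S\<^sub>p l"
      using payoff_zero_stakes_ge best(1)[OF idle] by (rule order_trans) (use data in auto)
    then show ?thesis using payoff_MInf_or_real[of m_ninf m_pinf m_star S\<^sub>p S\<^sub>m S\<^sub>p l] by auto
  qed
  then obtain m where m: "\<And>l. ?M S\<^sub>p S\<^sub>m S\<^sub>p l = ereal (m l)" and m_ge: "\<And>l. m_star \<le> m l"
    by metis
  have "\<exists>x. ?N S\<^sub>m S\<^sub>m S\<^sub>p l = ereal x \<and> n_star \<le> x" for l
  proof -
    have "ereal n_star \<le> ?N S\<^sub>m S\<^sub>m S\<^sub>p l"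
      using payoff_zero_stakes_ge best(2)[OF idle] by (rule order_trans) (use data in auto)
    then show ?thesis using payoff_MInf_or_real[of n_ninf n_pinf n_star S\<^sub>m S\<^sub>m S\<^sub>p l] by auto
  qed
  then obtain n where n: "\<And>l. ?N S\<^sub>m S\<^sub>m S\<^sub>p l = ereal (n l)" and n_ge: "\<And>l. n_star \<le> n l"
    by metis
  have m_le: "m l \<le> m_pinf" and n_le: "n l \<le> n_ninf" for l
    using payoff_le_max[OF m] payoff_le_max[OF n] data by simp_all
  have dev: "S([i] := s) \<in> strategies" if "S \<in> strategies" "0 \<le> s" for S i s
    using that singleton_paths_from[of i, THEN paths_fromD]
    by (auto simp: strategies_def PiE_def extensional_def)
  \<comment> \<open>Each stake at \<open>i\<close> is a one-shot deviation, so the equilibrium stake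
    is a best reply to the opponent's stake with \<open>m\<close> as continuation value.\<close>
  have max_m: "stake_value (m (i + 1)) (m (i - 1)) (b i) s \<le> m i" if "0 \<le> s" for i s
    using best(1)[OF dev[OF time_invariantD(1)[OF inv(2)] that], of i i] one_shot_deviation(1)[OF inv that m m, of i]
    by (simp add: m b_def)
  have max_n: "stake_value (n (i - 1)) (n (i + 1)) (a i) s \<le> n i" if "0 \<le> s" for i s
    using best(2)[OF dev[OF time_invariantD(1)[OF inv(1)] that], of i i] one_shot_deviation(2)[OF inv that n n, of i]
    by (simp add: n a_def)
  have m_eq: "m i = stake_value (m (i + 1)) (m (i - 1)) (b i) (a i)" for i
    using one_shot_deviation(1)[OF inv nonneg(1)[of i] m m, of i] by (simp add: m a_def b_def)
  have n_eq: "n i = stake_value (n (i - 1)) (n (i + 1)) (a i) (b i)" for i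
    using one_shot_deviation(2)[OF inv nonneg(2)[of i] n n, of i] by (simp add: n a_def b_def)
  have mean_m: "m l \<le> mean_terminal m_ninf m_pinf m_star S\<^sub>m S\<^sub>p l"
    and mean_n: "n l \<le> mean_terminal n_ninf n_pinf n_star S\<^sub>m S\<^sub>p l" for l
    using m[of l] n[of l] enn2real_nonneg unfolding payoff_finite_iff by simp_all
  consider "\<forall>i. a i = 0 \<and> b i = 0" | "\<forall>i. 0 < a i \<and> 0 < b i \<and> m i < m (i + 1) \<and> n (i + 1) < n i"
    using stakes_all_or_none[OF nonneg m_eq n_eq max_m max_n] by blast
  then show thesis
  proof cases
    case 1
    \<comment> \<open>On every outcome the two receipts fall short of \<open>m_pinf + n_ninf\<close>
      by at least \<open>\<delta>\<close>, while deviations would secure all but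
      \<open>2 * \<epsilon> = \<delta> / 2\<close> of that sum.\<close>
    define \<delta> where "\<delta> = min (m_pinf - m_ninf) (n_ninf - n_pinf)"
    define \<epsilon> where "\<epsilon> = \<delta> / 4"
    have \<epsilon>: "0 < \<epsilon>" using data by (simp add: \<epsilon>_def \<delta>_def)
    have "?M (vanishing_stakes \<epsilon>) S\<^sub>m (vanishing_stakes \<epsilon>) 0 = ereal (m_pinf - \<epsilon>)"
      by (rule payoff_vanishing_stakes_Maxine[OF \<epsilon>]) (use S 1 in auto)
    then have "m_pinf - \<epsilon> \<le> mean_terminal m_ninf m_pinf m_star S\<^sub>m S\<^sub>p 0"
      using best(1)[OF vanishing_stakes_strategy, of \<epsilon> 0] \<epsilon> mean_m[of 0] by (simp add: m)
    moreover have "?N (vanishing_stakes \<epsilon>) (vanishing_stakes \<epsilon>) S\<^sub>p 0 = ereal (n_ninf - \<epsilon>)"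
      by (rule payoff_vanishing_stakes_Mina[OF \<epsilon>]) (use S 1 in auto)
    then have "n_ninf - \<epsilon> \<le> mean_terminal n_ninf n_pinf n_star S\<^sub>m S\<^sub>p 0"
      using best(2)[OF vanishing_stakes_strategy, of \<epsilon> 0] \<epsilon> mean_n[of 0] by (simp add: n)
    moreover have "mean_terminal m_ninf m_pinf m_star S\<^sub>m S\<^sub>p 0 + mean_terminal n_ninf n_pinf n_star S\<^sub>m S\<^sub>p 0
        \<le> m_pinf + n_ninf - \<delta>"
    proof -
      interpret prob_space "law S\<^sub>m S\<^sub>p 0" by (rule prob_space_play_law)
      have "terminal_receipt m_ninf m_pinf m_star X + terminal_receipt n_ninf n_pinf n_star X \<le> m_pinf + n_ninf - \<delta>" for X
        using data by (auto simp: terminal_receipt_def \<delta>_def min_def)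
      then have "(\<integral>X. terminal_receipt m_ninf m_pinf m_star X + terminal_receipt n_ninf n_pinf n_star X \<partial>law S\<^sub>m S\<^sub>p 0)
          \<le> m_pinf + n_ninf - \<delta>"
        by (intro integral_le_const) (auto simp: integrable_terminal_receipt)
      then show ?thesis by (simp add: mean_terminal_def integrable_terminal_receipt)
    qed
    ultimately have False using \<epsilon> by (simp add: \<epsilon>_def)
    then show thesis ..
  next
    case 2
    have pos: "0 < a i" "0 < b i" and mono: "m i < m (i + 1)" "n (i + 1) < n i" for i using 2 by blast+
    have "m i \<le> m (i + 1)" for i using mono(1)[of i] by simp
    note m_limits = bounded_mono_int_limits[of m, OF this m_ge m_le]
    \<comment> \<open>These limits exist by monotonicity; that they are the terminal receipts is
      shown only at the end.\<close>
    obtain mm mp where lim_m: "(\<lambda>k. m (int k)) \<longlonglongrightarrow> mp" "(\<lambda>k. m (- int k)) \<longlonglongrightarrow> mm"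
      and m_lim_bounds: "\<And>i. mm \<le> m i" "\<And>i. m i \<le> mp"
      by (rule m_limits) (rule that)
    have "- n i \<le> - n (i + 1)" "- n_ninf \<le> - n i" "- n i \<le> - n_star" for i
      using mono(2)[of i] n_ge[of i] n_le[of i] by simp_all
    note n_limits = bounded_mono_int_limits[of "\<lambda>i. - n i", OF this]
    obtain nm' np' where n': "(\<lambda>k. - n (int k)) \<longlonglongrightarrow> np'" "(\<lambda>k. - n (- int k)) \<longlonglongrightarrow> nm'"
      "\<And>i. nm' \<le> - n i" "\<And>i. - n i \<le> np'"
      by (rule n_limits) (rule that)
    define nm where "nm = - nm'"
    define np where "np = - np'"
    have lim_n: "(\<lambda>k. n (int k)) \<longlonglongrightarrow> np" "(\<lambda>k. n (- int k)) \<longlonglongrightarrow> nm"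
      using tendsto_minus[OF n'(1)] tendsto_minus[OF n'(2)] by (simp_all add: np_def nm_def)
    have n_lim_bounds: "n i \<le> nm" "np \<le> n i" for i
      using n'(3,4)[of i] by (simp_all add: np_def nm_def)
    note Lm = tendsto_int_at_top[OF lim_m(1)] tendsto_int_at_bot[OF lim_m(2)]
      and Ln = tendsto_int_at_top[OF lim_n(1)] tendsto_int_at_bot[OF lim_n(2)]
    have step_m: "m (last \<psi>) + S\<^sub>p \<psi> =
        up (S\<^sub>m \<psi>) (S\<^sub>p \<psi>) * m (last \<psi> + 1) + (1 - up (S\<^sub>m \<psi>) (S\<^sub>p \<psi>)) * m (last \<psi> - 1)"
      if "\<psi> \<in> paths_from l" for \<psi> l
      using m_eq[of "last \<psi>"] by (simp add: S[OF that] stake_value_def)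
    have step_n: "n (last \<psi>) + S\<^sub>m \<psi> =
        up (S\<^sub>m \<psi>) (S\<^sub>p \<psi>) * n (last \<psi> + 1) + (1 - up (S\<^sub>m \<psi>) (S\<^sub>p \<psi>)) * n (last \<psi> - 1)"
      if "\<psi> \<in> paths_from l" for \<psi> l
      using n_eq[of "last \<psi>"] by (simp add: S[OF that] stake_value_Mina)
    \<comment> \<open>The martingale argument applies with terminal receipts read off from
      \<open>m\<close> and \<open>n\<close> themselves.\<close>
    have escape: "AE X in law S\<^sub>m S\<^sub>p l. filterlim X at_top sequentially \<or> filterlim X at_bot sequentially"
      and mart_m: "payoff mm mp w S\<^sub>p S\<^sub>m S\<^sub>p l = ereal (m l)"
      and mart_n: "payoff nm np w S\<^sub>m S\<^sub>m S\<^sub>p l = ereal (n l)" for l w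
    proof -
      note m_lim = martingale_limit[where S=S\<^sub>p and f=m, OF S(1)[where l=l] pos(1) step_m[where l=l]
          m_lim_bounds Lm]
      note n_lim = martingale_limit[where S=S\<^sub>m and f=n, OF S(2)[where l=l] pos(2) step_n[where l=l]
          n_lim_bounds(2,1) Ln]
      show "AE X in law S\<^sub>m S\<^sub>p l. filterlim X at_top sequentially \<or> filterlim X at_bot sequentially"
        by (rule m_lim(1))
      show "payoff mm mp w S\<^sub>p S\<^sub>m S\<^sub>p l = ereal (m l)" by (rule m_lim(2))
      show "payoff nm np w S\<^sub>m S\<^sub>m S\<^sub>p l = ereal (n l)" by (rule n_lim(2))
    qed
    define h where "h l = mean_terminal 0 1 0 S\<^sub>m S\<^sub>p l" for l
    have h: "0 \<le> h l" "h l \<le> 1" for l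
      unfolding h_def using mean_terminal_bounds[of 0 0 1 0 1] by simp_all
    note mean_h = mean_terminal_escape[OF escape, folded h_def]
    \<comment> \<open>The payoffs with receipts \<open>mm\<close>, \<open>mp\<close> and with the
      actual receipts have the same value and the same finite mean cost, so their mean terminal
      receipts agree.\<close>
    have rel_m: "mm + (mp - mm) * h l = m_ninf + (m_pinf - m_ninf) * h l" for l
      using mart_m[where w=m_star and l=l] m[of l] unfolding payoff_finite_iff mean_h by simp
    have rel_n: "nm + (np - nm) * h l = n_ninf + (n_pinf - n_ninf) * h l" for l
      using mart_n[where w=n_star and l=l] n[of l] unfolding payoff_finite_iff mean_h by simp
    \<comment> \<open>If the escape probability were constant, the mean terminal receipts
      \<open>V\<close> and \<open>W\<close> would not depend on the start and would bound
      \<open>m\<close> and \<open>n\<close> everywhere.\<close>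
    obtain l where l: "h l \<noteq> h 0"
    proof (rule ccontr)
      assume "\<not> thesis"
      then have const: "h l = h 0" for l using that by blast
      define V where "V = m_ninf + (m_pinf - m_ninf) * h 0"
      define W where "W = n_ninf + (n_pinf - n_ninf) * h 0"
      have le: "m l \<le> V" "n l \<le> W" for l
        using mean_m[of l] mean_n[of l] unfolding mean_h const[of l] by (simp_all add: V_def W_def)
      \<comment> \<open>Strictness comes from strict monotonicity:
        \<open>mm \<le> m 0 < m 1 \<le> V\<close> and
        \<open>np \<le> n 1 < n 0 \<le> W\<close>.\<close>
      have "mm < V" "np < W"
        using m_lim_bounds(1)[of 0] mono(1)[of 0] le(1)[of 1] n_lim_bounds(2)[of 1] mono(2)[of 0] le(2)[of 0]
        by simp_all
      moreover have "mp \<le> V" "nm \<le> W"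
        using LIMSEQ_le_const2[OF lim_m(1)] LIMSEQ_le_const2[OF lim_n(2)] le by blast+
      ultimately have "mp \<le> V" "mm < V" "nm \<le> W" "np < W" by simp_all
      note VW = this
      \<comment> \<open>\<open>V\<close> is the \<open>h 0\<close>-average of the limits
        \<open>mp\<close> and \<open>mm\<close>, neither of which exceeds it, so each weighted gap
        vanishes; likewise for \<open>W\<close>. The strict gaps then force \<open>h 0 = 1\<close>
        for \<open>m\<close> and \<open>h 0 = 0\<close> for \<open>n\<close>.\<close>
      have V: "(V - mp) * h 0 + (V - mm) * (1 - h 0) = 0"
        using rel_m[of 0] by (simp add: V_def algebra_simps)
      have W: "(W - np) * h 0 + (W - nm) * (1 - h 0) = 0"
        using rel_n[of 0] by (simp add: W_def algebra_simps)
      have "0 \<le> (V - mp) * h 0" "0 \<le> (V - mm) * (1 - h 0)"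
        "0 \<le> (W - np) * h 0" "0 \<le> (W - nm) * (1 - h 0)"
        using VW h[of 0] by simp_all
      with V W have "(V - mm) * (1 - h 0) = 0" "(W - np) * h 0 = 0" by linarith+
      then show False using VW by simp
    qed
    have bd: "mm = m_ninf" "mp = m_pinf" "nm = n_ninf" "np = n_pinf"
      using affine_relation_coeffs[OF rel_m[of l] rel_m[of 0] l]
        affine_relation_coeffs[OF rel_n[of l] rel_n[of 0] l] by simp_all
    show thesis
    proof (rule that[of "(a, b, m, n)"])
      show "associated_quadruple \<kappa> \<rho> m_star n_star m_ninf m_pinf n_ninf n_pinf (S\<^sub>m, S\<^sub>p) (a, b, m, n)"
        by (simp add: associated_quadruple_def mean_receipt_eq_payoff m n a_def b_def)
      show "(a, b, m, n) \<in> ABMN \<kappa> \<rho>"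
        unfolding ABMN_stake_values
      proof (intro allI conjI pos m_eq n_eq)
        fix i
        show "(a i powr \<rho> + b i powr \<rho>)\<^sup>2 = \<rho> * \<kappa> * a i powr (\<rho> - 1) * b i powr \<rho> * (m (i + 1) - m (i - 1))"
          by (rule optimal_stake_critical[OF pos]) (use max_m[of _ i] m_eq[of i] in simp)
        show "(b i powr \<rho> + a i powr \<rho>)\<^sup>2 = \<rho> * \<kappa> * b i powr (\<rho> - 1) * a i powr \<rho> * (n (i - 1) - n (i + 1))"
          by (rule optimal_stake_critical[OF pos(2,1)]) (use max_n[of _ i] n_eq[of i] in simp)
      qed
      show "has_boundary_data (a, b, m, n) m_ninf m_pinf n_ninf n_pinf"
        using lim_m lim_n by (simp add: has_boundary_data_def bd)
    qed
  qed
qed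

end

theorem theorem1p3:
  fixes \<kappa> \<rho> m_ninf m_pinf n_ninf n_pinf m_star n_star :: real
  assumes "0 < \<kappa>" "\<kappa> \<le> 1" "0 < \<rho>" "\<rho> \<le> 1"
    and "m_ninf < m_pinf" "n_pinf < n_ninf"
    and "m_star < m_ninf" "n_star < n_pinf"
  shows
    "(\<forall>S\<^sub>m\<in>time_invariant_strategies. \<forall>S\<^sub>p\<in>time_invariant_strategies.
       (S\<^sub>m, S\<^sub>p) \<in> nash_equilibria \<kappa> \<rho> m_star n_star m_ninf m_pinf n_ninf n_pinf \<longrightarrow>
       (\<exists>q. associated_quadruple \<kappa> \<rho> m_star n_star m_ninf m_pinf n_ninf n_pinf (S\<^sub>m, S\<^sub>p) q \<and>
            q \<in> ABMN \<kappa> \<rho> \<and> has_boundary_data q m_ninf m_pinf n_ninf n_pinf)) \<and>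
     (\<forall>a b m n. (a, b, m, n) \<in> ABMN \<kappa> \<rho> \<and>
       has_boundary_data (a, b, m, n) m_ninf m_pinf n_ninf n_pinf \<longrightarrow>
       stationary_strategy b \<in> time_invariant_strategies \<and>
       stationary_strategy a \<in> time_invariant_strategies \<and>
       (stationary_strategy b, stationary_strategy a)
         \<in> nash_equilibria \<kappa> \<rho> m_star n_star m_ninf m_pinf n_ninf n_pinf)"
proof -
  interpret trail_of_lost_pennies \<kappa> \<rho> using assms by unfold_locales
  show ?thesis
  proof (intro conjI ballI allI impI; (elim conjE)?)
    fix S\<^sub>m S\<^sub>p
    assume "S\<^sub>m \<in> time_invariant_strategies" "S\<^sub>p \<in> time_invariant_strategies"
      "(S\<^sub>m, S\<^sub>p) \<in> nash_equilibria \<kappa> \<rho> m_star n_star m_ninf m_pinf n_ninf n_pinf"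
    from nash_imp_ABMN[OF this assms(5-8)]
    show "\<exists>q. associated_quadruple \<kappa> \<rho> m_star n_star m_ninf m_pinf n_ninf n_pinf (S\<^sub>m, S\<^sub>p) q \<and>
        q \<in> ABMN \<kappa> \<rho> \<and> has_boundary_data q m_ninf m_pinf n_ninf n_pinf"
      by blast
  next
    fix a b m n
    assume "(a, b, m, n) \<in> ABMN \<kappa> \<rho>" "has_boundary_data (a, b, m, n) m_ninf m_pinf n_ninf n_pinf"
    from ABMN_imp_nash[OF this less_imp_le[OF assms(7)] less_imp_le[OF assms(8)]]
    show "stationary_strategy b \<in> time_invariant_strategies"
      "stationary_strategy a \<in> time_invariant_strategies"
      "(stationary_strategy b, stationary_strategy a)
         \<in> nash_equilibria \<kappa> \<rho> m_star n_star m_ninf m_pinf n_ninf n_pinf"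
      by blast+
  qed
qed

end
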